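(* Let $N>p>1$, $s>-p$, $0<\mu<\bar\mu:=\big(\frac{N-p}{p}\big)^p$ and $q>p-1$. Let $\mathbf F=(F,G)$ be the vector field of the planar system $$\dot x=F(x,Y)=\frac{x^{2-p}}{p-1}\big[\mu+Y-h(x)\big],\qquad \dot Y=G(x,Y)=(q-p+1)\,Y\,(\gamma_*-x),$$ and set $$B(x,Y):=x^{p-2}\,Y^{b},\qquad b:=\frac{N-p}{p+s}-1\ (>-1).$$ Then $$\operatorname{div}(B\mathbf F)(x,Y)=\Big(p-\frac{N-p}{\gamma_*}\Big)x^{p-1}Y^{b}\qquad\text{for all }x>0,\ Y>0,$$ whose sign is negative if $q>p^*_s-1$, zero if $q=p^*_s-1$, and positive if $p-1<q<p^*_s-1$. Consequently: (i) if $q\ne p^*_s-1$, the system admits neither a periodic orbit nor a separatrix cycle in $\{x>0,\ Y\ge0\}$, and every solution $(x(t),Y(t))$ with $x>0$, $Y>0$ for which there is $t_0\in\mathbb R$ such that $0<x(t)<\nu_+$ for every $t\ge t_0$, $\liminf_{t\to\infty}x(t)>0$ and $\sup_{t\ge t_0}Y(t)<+\infty$, converges, as $t\to+\infty$, to one of the equilibria $P_*=(\gamma_*,h(\gamma_* )-\mu)$ (present only if $h(\gamma_* )>\mu$), $P_-=(\nu_-,0)$, $P_+=(\nu_+,0)$; (ii) if $q=p^*_s-1$, the field $B\mathbf F$ is Hamiltonian on $\{x>0,\ Y>0\}$: setting $$\mathcal H(x,Y):=\frac{Y^{b+1}}{p-1}\left[\frac{\mu-h(x)}{b+1}+\frac{Y}{b+2}\right],\qquad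 b+1=\frac{p}{q-p+1},$$ one has $\partial_Y\mathcal H=BF$ and $\partial_x\mathcal H=-BG$, so $\mathcal H$ is a first integral of the system.
   Context: $N,p,s,\mu,q$ are real parameters. Notation: $h(\gamma):=\gamma^{p-1}\big(N-p-(p-1)\gamma\big)$ for $\gamma>0$; $\nu_-<\nu_+$ are the two roots of $h(\nu)=\mu$, which satisfy $0<\nu_-<\frac{N-p}{p}<\nu_+<\frac{N-p}{p-1}$; $\gamma_*:=\frac{p+s}{q-p+1}$; $p^*_s:=\frac{p(N+s)}{N-p}$. A separatrix cycle is a compact invariant set consisting of finitely many equilibria together with orbits connecting them and bounding a region. *)

theory Defs
  imports "HOL-Analysis.Analysis"
begin

section \<open>Planar vector fields\<close>

definition has_divergence :: "(real \<times> real \<Rightarrow> real \<times> real) \<Rightarrow> real \<Rightarrow> real \<times> real \<Rightarrow> bool" where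
  "has_divergence V d z \<longleftrightarrow>
     (\<exists>D. (V has_derivative D) (at z) \<and> d = fst (D (1, 0)) + snd (D (0, 1)))"

definition solution_on :: "(real \<times> real \<Rightarrow> real \<times> real) \<Rightarrow> real set \<Rightarrow> (real \<Rightarrow> real \<times> real) \<Rightarrow> bool" where
  "solution_on V T \<gamma> \<longleftrightarrow> (\<forall>t\<in>T. (\<gamma> has_vector_derivative V (\<gamma> t)) (at t within T))"

definition equilibrium :: "(real \<times> real \<Rightarrow> real \<times> real) \<Rightarrow> real \<times> real \<Rightarrow> bool" where
  "equilibrium V z \<longleftrightarrow> V z = 0"

text \<open>Equilibria do not count as periodic orbits.\<close>

definition periodic_orbit :: "(real \<times> real \<Rightarrow> real \<times> real) \<Rightarrow> (real \<times> real) set \<Rightarrow> bool" where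
  "periodic_orbit V S \<longleftrightarrow>
     (\<exists>\<gamma>. solution_on V UNIV \<gamma> \<and> S = range \<gamma> \<and> \<not> \<gamma> constant_on UNIV \<and>
          (\<exists>T>0. \<forall>t. \<gamma> (t + T) = \<gamma> t))"

definition invariant_set :: "(real \<times> real \<Rightarrow> real \<times> real) \<Rightarrow> (real \<times> real) set \<Rightarrow> bool" where
  "invariant_set V S \<longleftrightarrow>
     (\<forall>z\<in>S. \<exists>\<gamma>. solution_on V UNIV \<gamma> \<and> \<gamma> 0 = z \<and> range \<gamma> \<subseteq> S)"

text \<open>
  The orbits in \<open>\<Gamma>\<close> are defined for all times and tend to members of the finite set \<open>E\<close> of
  equilibria in both time directions; homoclinic orbits are allowed.  That \<open>S\<close> bounds a region
  means that its complement has a bounded connected component.  This covers sets that are the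
  whole boundary of a region as well as, for instance, a figure eight.
\<close>

definition separatrix_cycle :: "(real \<times> real \<Rightarrow> real \<times> real) \<Rightarrow> (real \<times> real) set \<Rightarrow> bool" where
  "separatrix_cycle V S \<longleftrightarrow>
     compact S \<and> invariant_set V S \<and>
     (\<exists>E \<Gamma>. finite E \<and> (\<forall>e\<in>E. equilibrium V e) \<and>
        (\<forall>\<gamma>\<in>\<Gamma>. solution_on V UNIV \<gamma> \<and>
           (\<exists>e\<in>E. (\<gamma> \<longlongrightarrow> e) at_bot) \<and> (\<exists>e\<in>E. (\<gamma> \<longlongrightarrow> e) at_top)) \<and>
        S = E \<union> (\<Union>\<gamma>\<in>\<Gamma>. range \<gamma>)) \<and>
     (\<exists>D\<in>components (- S). bounded D)"

text \<open>\<open>V = (\<partial>\<^sub>Y H, - \<partial>\<^sub>x H)\<close> on \<open>A\<close>.\<close>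

definition hamiltonian_on ::
    "(real \<times> real) set \<Rightarrow> (real \<times> real \<Rightarrow> real) \<Rightarrow> (real \<times> real \<Rightarrow> real \<times> real) \<Rightarrow> bool" where
  "hamiltonian_on A H V \<longleftrightarrow>
     (\<forall>x Y. (x, Y) \<in> A \<longrightarrow>
        H differentiable at (x, Y) \<and>
        ((\<lambda>\<eta>. H (x, \<eta>)) has_real_derivative fst (V (x, Y))) (at Y) \<and>
        ((\<lambda>\<xi>. H (\<xi>, Y)) has_real_derivative - snd (V (x, Y))) (at x))"

definition first_integral_on ::
    "(real \<times> real) set \<Rightarrow> (real \<times> real \<Rightarrow> real) \<Rightarrow> (real \<times> real \<Rightarrow> real \<times> real) \<Rightarrow> bool" where
  "first_integral_on A H V \<longleftrightarrow>
     (\<forall>T \<gamma>. is_interval T \<and> solution_on V T \<gamma> \<and> \<gamma> ` T \<subseteq> A \<longrightarrow> (H \<circ> \<gamma>) constant_on T)"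


section \<open>The system\<close>

text \<open>The real powers below are only meaningful for a positive base.\<close>

definition h :: "real \<Rightarrow> real \<Rightarrow> real \<Rightarrow> real" where
  "h N p \<gamma> = \<gamma> powr (p - 1) * (N - p - (p - 1) * \<gamma>)"

definition mu_bar :: "real \<Rightarrow> real \<Rightarrow> real" where
  "mu_bar N p = ((N - p) / p) powr p"

definition gamma_star :: "real \<Rightarrow> real \<Rightarrow> real \<Rightarrow> real" where
  "gamma_star p s q = (p + s) / (q - p + 1)"

definition p_star :: "real \<Rightarrow> real \<Rightarrow> real \<Rightarrow> real" where
  "p_star N p s = p * (N + s) / (N - p)"

definition field :: "real \<Rightarrow> real \<Rightarrow> real \<Rightarrow> real \<Rightarrow> real \<Rightarrow> real \<times> real \<Rightarrow> real \<times> real" where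
  "field N p s \<mu> q = (\<lambda>(x, Y).
     (x powr (2 - p) / (p - 1) * (\<mu> + Y - h N p x),
      (q - p + 1) * Y * (gamma_star p s q - x)))"

definition dulac_b :: "real \<Rightarrow> real \<Rightarrow> real \<Rightarrow> real" where
  "dulac_b N p s = (N - p) / (p + s) - 1"

definition dulac_B :: "real \<Rightarrow> real \<Rightarrow> real \<Rightarrow> real \<times> real \<Rightarrow> real" where
  "dulac_B N p s = (\<lambda>(x, Y). x powr (p - 2) * Y powr dulac_b N p s)"

definition weighted_field :: "real \<Rightarrow> real \<Rightarrow> real \<Rightarrow> real \<Rightarrow> real \<Rightarrow> real \<times> real \<Rightarrow> real \<times> real" where
  "weighted_field N p s \<mu> q = (\<lambda>z. dulac_B N p s z *\<^sub>R field N p s \<mu> q z)"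

definition dulac_div :: "real \<Rightarrow> real \<Rightarrow> real \<Rightarrow> real \<Rightarrow> real \<Rightarrow> real \<Rightarrow> real" where
  "dulac_div N p s q x Y =
     (p - (N - p) / gamma_star p s q) * x powr (p - 1) * Y powr dulac_b N p s"

definition hamiltonian :: "real \<Rightarrow> real \<Rightarrow> real \<Rightarrow> real \<Rightarrow> real \<times> real \<Rightarrow> real" where
  "hamiltonian N p s \<mu> = (\<lambda>(x, Y).
     Y powr (dulac_b N p s + 1) / (p - 1) *
       ((\<mu> - h N p x) / (dulac_b N p s + 1) + Y / (dulac_b N p s + 2)))"

end

theory Submission
  imports Defs
begin

text \<open>
  Write \<open>k = q - p + 1\<close>, \<open>g = \<gamma>\<^sub>*\<close> and \<open>c = N - p - p g\<close>, so that \<open>c = 0\<close> exactly in the critical case. Instead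
  of Green's theorem and Poincare-Bendixson theory one can use the Lyapunov function
  \<open>V = Y\<^bsup>p/k\<^esup> ((p-1) x\<^sup>p / p - g x\<^bsup>p-1\<^esup> + (\<mu> - c g\<^bsup>p-1\<^esup>) / p + Y / (q+1))\<close>, whose derivative along the flow is
  \<open>- c Y\<^bsup>p/k\<^esup> (x - g) (x\<^bsup>p-1\<^esup> - g\<^bsup>p-1\<^esup>)\<close>. It is strictly monotone on every orbit with \<open>Y > 0\<close> other than the
  equilibrium \<open>P\<^sub>*\<close>, which excludes periodic orbits. For a bounded solution Barbalat's lemma shows that
  \<open>V'\<close> tends to \<open>0\<close>, and elementary arguments on limit points give convergence.

  Since \<open>V = 0\<close> on the axis and \<open>V(P\<^sub>*) < 0\<close>, a nonconstant orbit in a separatrix cycle that leaves the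
  axis joins a saddle on the axis to \<open>P\<^sub>*\<close>. The saddle and the direction are determined by the sign of
  \<open>c\<close>, and the orbit is unique. The cycle is therefore contained in a segment of the axis together with
  either \<open>P\<^sub>*\<close> or one arc, and such a set does not separate the plane.
\<close>

section \<open>Real functions of one variable\<close>

text \<open>In the critical case \<open>b + 1 = p / k\<close>, and \<open>V\<close> is then
  \<open>(p - 1) / k\<close> times the Hamiltonian. Off criticality one looks for \<open>V\<close>
  of the same shape \<open>Y^a (P(x) + d Y)\<close>. The choice
  \<open>P' = (p - 1) x^(p - 2) (x - g)\<close> cancels the prefactor of \<open>x'\<close> and gives
  both contributions to \<open>V'\<close> the factor \<open>x - g\<close>. In the remaining factor
  \<open>a = p / k\<close> removes the \<open>x^p\<close> terms and leaves
  \<open>c x^(p - 1)\<close> plus a constant, \<open>d = 1 / (q + 1)\<close> removes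
  \<open>Y\<close>, and the constant in \<open>P\<close> makes it vanish at \<open>x = g\<close>, so
  that \<open>V'\<close> keeps its sign. Unlike the Dulac factor, whose exponent \<open>b\<close>
  may be negative, \<open>V\<close> extends continuously to the axis because
  \<open>p / k > 0\<close>; cycles and limits may touch \<open>Y = 0\<close>. There \<open>V\<close>
  vanishes identically and says nothing, so motion on the axis is treated separately. Uniqueness of
  the connecting orbit is essential, since two of them would enclose a region. The slope
  \<open>F / G\<close> is singular on the axis, so uniqueness for initial values does not reach the
  saddle; monotonicity of the slope in \<open>x\<close> replaces it.\<close>

lemma gronwall_zero:
  fixes w w' :: "real \<Rightarrow> real"
  assumes w': "\<And>t. t \<in> {a..b} \<Longrightarrow> (w has_real_derivative w' t) (at t)"
    and bound: "\<And>t. t \<in> {a..b} \<Longrightarrow> \<bar>w' t\<bar> \<le> L * w t"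
    and nonneg: "\<And>t. t \<in> {a..b} \<Longrightarrow> 0 \<le> w t"
    and c: "c \<in> {a..b}" "w c = 0" and t: "t \<in> {a..b}"
  shows "w t = 0"
proof -
  have "w t \<le> 0"
  \<comment> \<open>The two-sided bound on \<open>w'\<close> propagates the zero in both time
    directions: \<open>w t * exp (- L * t)\<close> does not increase to the right of
    \<open>c\<close>, and \<open>w t * exp (L * t)\<close> does not decrease to its left.\<close>
  proof (cases "c \<le> t")
    case True
    have "w t * exp (- L * t) \<le> w c * exp (- L * c)"
    proof (rule DERIV_nonpos_imp_nonincreasing[OF True])
      fix u assume "c \<le> u" "u \<le> t"
      then have u: "u \<in> {a..b}" using c t by auto
      have "((\<lambda>t. w t * exp (- L * t)) has_real_derivative (w' u - L * w u) * exp (- L * u)) (at u)"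
        by (rule derivative_eq_intros w'[OF u] refl)+ (simp add: algebra_simps)
      moreover have "(w' u - L * w u) * exp (- L * u) \<le> 0"
        using bound[OF u] by (intro mult_nonpos_nonneg) auto
      ultimately show "\<exists>y. ((\<lambda>t. w t * exp (- L * t)) has_real_derivative y) (at u) \<and> y \<le> 0"
        by blast
    qed
    then show ?thesis using c by (simp add: mult_le_0_iff)
  next
    case False
    then have "t \<le> c" by simp
    have "w t * exp (L * t) \<le> w c * exp (L * c)"
    proof (rule DERIV_nonneg_imp_nondecreasing[OF \<open>t \<le> c\<close>])
      fix u assume "t \<le> u" "u \<le> c"
      then have u: "u \<in> {a..b}" using c t by auto
      have "((\<lambda>t. w t * exp (L * t)) has_real_derivative (w' u + L * w u) * exp (L * u)) (at u)"
        by (rule derivative_eq_intros w'[OF u] refl)+ (simp add: algebra_simps)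
      moreover have "0 \<le> (w' u + L * w u) * exp (L * u)"
        using bound[OF u] by (intro mult_nonneg_nonneg) auto
      ultimately show "\<exists>y. ((\<lambda>t. w t * exp (L * t)) has_real_derivative y) (at u) \<and> 0 \<le> y"
        by blast
    qed
    then show ?thesis using c by (simp add: mult_le_0_iff)
  qed
  then show ?thesis using nonneg[OF t] by simp
qed

lemma antimono_bounded_tendsto:
  fixes f :: "real \<Rightarrow> real"
  assumes anti: "\<And>s t. t0 < s \<Longrightarrow> s \<le> t \<Longrightarrow> f t \<le> f s" and bdd: "\<And>t. t0 < t \<Longrightarrow> m \<le> f t"
  obtains L where "(f \<longlongrightarrow> L) at_top"
proof
  define L where "L = Inf (f ` {t0<..})"
  have bb: "bdd_below (f ` {t0<..})" using bdd by (intro bdd_belowI[of _ m]) auto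
  show "(f \<longlongrightarrow> L) at_top"
  proof (rule order_tendstoI)
    fix a assume "a < L"
    moreover have "L \<le> f t" if "t0 < t" for t
      unfolding L_def using bb that by (intro cInf_lower) auto
    ultimately have "a < f t" if "t0 < t" for t using that by fastforce
    then show "eventually (\<lambda>t. a < f t) at_top"
      by (auto intro: eventually_at_top_linorderI[of "t0 + 1"])
  next
    fix a assume "L < a"
    then obtain s where "t0 < s" "f s < a"
      unfolding L_def using cInf_less_iff[of "f ` {t0<..}" a] bb by auto
    then show "eventually (\<lambda>t. f t < a) at_top"
      using anti by (intro eventually_at_top_linorderI[of s]) fastforce
  qed
qed

lemma barbalat:
  fixes f f' :: "real \<Rightarrow> real"
  assumes f': "\<And>t. t0 < t \<Longrightarrow> (f has_real_derivative f' t) (at t)"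
    and lim: "(f \<longlongrightarrow> L) at_top" and uc: "uniformly_continuous_on {t0<..} f'"
  shows "(f' \<longlongrightarrow> 0) at_top"
proof (rule tendstoI)
  fix e :: real assume "0 < e"
  then obtain d where d: "d > 0"
    "\<And>s t. t0 < s \<Longrightarrow> t0 < t \<Longrightarrow> dist s t < d \<Longrightarrow> dist (f' s) (f' t) < e / 2"
    using uc unfolding uniformly_continuous_on_def
    by (metis greaterThan_iff half_gt_zero)
  \<comment> \<open>\<open>r < d\<close> keeps the mean value point \<open>z\<close> within
    \<open>d\<close> of \<open>t\<close>. The tolerance \<open>e * r / 4\<close> at both ends bounds
    the increment of \<open>f\<close> by \<open>e * r / 2\<close>, hence
    \<open>\<bar>f' z\<bar>\<close> by \<open>e / 2\<close>; uniform continuity supplies the other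
    half.\<close>
  define r where "r = d / 2"
  have r: "0 < r" "r < d" using d by (auto simp: r_def)
  have "eventually (\<lambda>t. dist (f t) L < e * r / 4) at_top"
    using lim \<open>0 < e\<close> r by (intro tendstoD) auto
  then obtain T where T: "\<And>t. t \<ge> T \<Longrightarrow> dist (f t) L < e * r / 4"
    by (auto simp: eventually_at_top_linorder)
  show "eventually (\<lambda>t. dist (f' t) 0 < e) at_top"
  proof (rule eventually_at_top_linorderI[of "max T (t0 + 1)"])
    fix t assume t: "max T (t0 + 1) \<le> t"
    obtain z where z: "t < z" "z < t + r" "f (t + r) - f t = (t + r - t) * f' z"
      using MVT2[of t "t + r" f f'] f' t r by auto
    have "\<bar>f (t + r) - f t\<bar> < e * r / 2"
      using T[of t] T[of "t + r"] t r by (auto simp: dist_real_def abs_if split: if_splits)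
    then have "r * \<bar>f' z\<bar> < r * (e / 2)" using z r by (simp add: abs_mult mult.commute)
    then have "\<bar>f' z\<bar> < e / 2" using r by (simp only: mult_less_cancel_left_pos)
    moreover have "dist (f' z) (f' t) < e / 2"
      using d(2)[of z t] z t r by (auto simp: dist_real_def)
    ultimately show "dist (f' t) 0 < e" unfolding dist_real_def by linarith
  qed
qed

text \<open>Mean values over \<open>[t, t + 1]\<close> give points going to infinity at which
  \<open>f'\<close> is a difference of values of \<open>f\<close>, and these differences tend to
  \<open>0\<close>. Applied to \<open>x\<close>, this makes the limit of a convergent solution a
  zero of \<open>F\<close>.\<close>

lemma derivative_limit_zero:
  fixes f f' :: "real \<Rightarrow> real"
  assumes f': "\<And>t. t0 < t \<Longrightarrow> (f has_real_derivative f' t) (at t)"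
    and lim: "(f \<longlongrightarrow> L) at_top" and lim': "(f' \<longlongrightarrow> M) at_top"
  shows "M = 0"
proof -
  have "\<exists>z\<ge>t. f (t + 1) - f t = f' z" if "t0 < t" for t
  proof -
    have "\<exists>u>t. u < t + 1 \<and> f (t + 1) - f t = (t + 1 - t) * f' u"
      using f' that by (intro MVT2) auto
    then obtain u where "t < u" "f (t + 1) - f t = (t + 1 - t) * f' u" by blast
    then have "t \<le> u \<and> f (t + 1) - f t = f' u" by simp
    then show ?thesis ..
  qed
  then obtain z where z: "\<And>t. t0 < t \<Longrightarrow> z t \<ge> t \<and> f (t + 1) - f t = f' (z t)" by metis
  have zt: "filterlim z at_top at_top"
    using filterlim_ident
  proof (rule filterlim_at_top_mono)
    show "\<forall>\<^sub>F t in at_top. t \<le> z t"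
      using z by (intro eventually_at_top_linorderI[of "t0 + 1"]) auto
  qed
  have shift: "filterlim (\<lambda>t::real. t + 1) at_top at_top"
    by (rule filterlim_at_top_mono[OF filterlim_ident]) auto
  have "((\<lambda>t. f (t + 1) - f t) \<longlongrightarrow> L - L) at_top"
    by (intro tendsto_diff filterlim_compose[OF lim shift] lim)
  moreover have "\<forall>\<^sub>F t in at_top. f (t + 1) - f t = f' (z t)"
    using z by (intro eventually_at_top_linorderI[of "t0 + 1"]) auto
  ultimately have "((\<lambda>t. f' (z t)) \<longlongrightarrow> L - L) at_top"
    using tendsto_cong by fastforce
  moreover have "((\<lambda>t. f' (z t)) \<longlongrightarrow> M) at_top" by (rule filterlim_compose[OF lim' zt])
  ultimately show ?thesis using tendsto_unique[of "at_top :: real filter"] by auto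
qed

text \<open>At a first zero \<open>f\<close> would have come down from positive values, which a
  positive derivative forbids. This expresses that a flow crosses a vertical line in one direction
  only.\<close>

lemma positive_preserved_if_increasing_at_zeros:
  fixes f f' :: "real \<Rightarrow> real"
  assumes f': "\<And>t. a \<le> t \<Longrightarrow> (f has_real_derivative f' t) (at t)"
    and zero: "\<And>t. a \<le> t \<Longrightarrow> f t = 0 \<Longrightarrow> 0 < f' t" and "0 < f a" "a \<le> b"
  shows "0 < f b"
proof (rule ccontr)
  assume neg: "\<not> 0 < f b"
  have cont: "continuous_on {a..b} f"
    using f' by (intro DERIV_atLeastAtMost_imp_continuous_on) auto
  define Z where "Z = {a..b} \<inter> f -` {..0}"
  have "closed Z"
    unfolding Z_def by (intro continuous_closed_preimage cont) auto
  moreover have "bounded Z" unfolding Z_def by (rule bounded_subset[OF bounded_closed_interval[of a b]]) auto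
  ultimately have "compact Z" by (simp add: compact_eq_bounded_closed)
  moreover have "b \<in> Z" using neg \<open>a \<le> b\<close> by (auto simp: Z_def)
  ultimately obtain c where c: "c \<in> Z" "\<And>t. t \<in> Z \<Longrightarrow> c \<le> t"
    using compact_attains_inf[of Z] by auto
  have "a < c" using c(1) \<open>0 < f a\<close> by (cases "a = c") (auto simp: Z_def)
  have pos: "0 < f t" if "a \<le> t" "t < c" for t
    using c that by (force simp: Z_def)
  have "continuous (at c) f" using f'[of c] \<open>a < c\<close> by (intro DERIV_continuous) auto
  have "f c = 0"
  proof (rule antisym)
    show "f c \<le> 0" using c by (auto simp: Z_def)
    have "(f \<longlongrightarrow> f c) (at_left c)"
      using \<open>continuous (at c) f\<close> by (simp add: continuous_within tendsto_within_subset[of _ _ _ UNIV])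
    then show "0 \<le> f c"
      by (rule tendsto_lowerbound)
        (use \<open>a < c\<close> pos in \<open>auto simp: eventually_at_left intro!: exI[of _ a] less_imp_le\<close>)
  qed
  then have "0 < f' c" using zero \<open>a < c\<close> by simp
  then obtain d where "d > 0" "\<And>e. 0 < e \<Longrightarrow> e < d \<Longrightarrow> f (c - e) < f c"
    using DERIV_pos_inc_left[OF f'[of c]] \<open>a < c\<close> by auto
  then have "f (c - min (d / 2) (c - a)) < 0"
    using \<open>f c = 0\<close> \<open>a < c\<close> by (auto simp: min_def)
  then show False using pos[of "c - min (d / 2) (c - a)"] \<open>a < c\<close> \<open>d > 0\<close> by (auto simp: min_def split: if_splits)
qed

text \<open>An oscillating \<open>u\<close> would cross every level between its lower and upper
  limit again and again. One eventually one-sided level in that gap rules this out, so it suffices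
  to have such levels densely.\<close>

lemma tendsto_if_levels_eventually_one_sided:
  fixes u :: "real \<Rightarrow> real"
  assumes bdd: "\<And>t. t0 < t \<Longrightarrow> u t \<in> {a..b}"
    and level: "\<And>y1 y2. y1 < y2 \<Longrightarrow> a \<le> y1 \<Longrightarrow> \<exists>y. y1 < y \<and> y < y2 \<and>
       (eventually (\<lambda>t. u t \<le> y) at_top \<or> eventually (\<lambda>t. y \<le> u t) at_top)"
  obtains l where "l \<in> {a..b}" "(u \<longlongrightarrow> l) at_top"
proof -
  define A where "A = {y. eventually (\<lambda>t. y \<le> u t) at_top}"
  have ev: "eventually (\<lambda>t. a \<le> u t \<and> u t \<le> b) at_top"
    using bdd by (intro eventually_at_top_linorderI[of "t0 + 1"]) auto
  then have "a \<in> A" by (auto simp: A_def elim: eventually_mono)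
  have ub: "y \<le> b" if "y \<in> A" for y
  proof -
    have "eventually (\<lambda>t. y \<le> b) (at_top :: real filter)"
      using that ev unfolding A_def mem_Collect_eq by eventually_elim auto
    then show ?thesis by simp
  qed
  define l where "l = Sup A"
  have bddA: "bdd_above A" using ub by (rule bdd_aboveI)
  have "a \<le> l" unfolding l_def using \<open>a \<in> A\<close> bddA by (rule cSup_upper)
  have "l \<le> b" unfolding l_def using \<open>a \<in> A\<close> ub by (intro cSup_least) auto
  have "(u \<longlongrightarrow> l) at_top"
  proof (rule order_tendstoI)
    fix y assume "y < l"
    then obtain y' where "y' \<in> A" "y < y'"
      unfolding l_def using less_cSup_iff[of A y] \<open>a \<in> A\<close> bddA by auto
    then show "eventually (\<lambda>t. y < u t) at_top" by (auto simp: A_def elim!: eventually_mono)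
  next
    fix y assume "l < y"
    then obtain y' where y': "l < y'" "y' < y"
       "eventually (\<lambda>t. u t \<le> y') at_top \<or> eventually (\<lambda>t. y' \<le> u t) at_top"
      using level[of l y] \<open>a \<le> l\<close> by auto
    \<comment> \<open>\<open>y'\<close> exceeds the supremum of \<open>A\<close>, which leaves only
      the alternative \<open>u t \<le> y'\<close>.\<close>
    have "y' \<notin> A" using y'(1) cSup_upper[OF _ bddA, of y'] by (auto simp: l_def)
    then have "eventually (\<lambda>t. u t \<le> y') at_top" using y'(3) by (auto simp: A_def)
    then show "eventually (\<lambda>t. u t < y) at_top" using y'(2) by (auto elim!: eventually_mono)
  qed
  then show thesis using that \<open>a \<le> l\<close> \<open>l \<le> b\<close> by auto
qed

section \<open>Plane topology\<close>

text \<open>Outside a compact time interval the curve stays in two members of the cover, one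
  containing \<open>a\<close> and one containing \<open>b\<close>.\<close>

lemma compact_range_with_limits:
  fixes f :: "real \<Rightarrow> 'a :: topological_space"
  assumes cont: "continuous_on UNIV f" and a: "(f \<longlongrightarrow> a) at_bot" and b: "(f \<longlongrightarrow> b) at_top"
  shows "compact (insert a (insert b (range f)))"
proof (rule compactI)
  fix C assume op: "\<forall>U\<in>C. open U" and cov: "insert a (insert b (range f)) \<subseteq> \<Union>C"
  then obtain Ua Ub where U: "Ua \<in> C" "a \<in> Ua" "Ub \<in> C" "b \<in> Ub" by auto
  then have "open Ua" "open Ub" using op by auto
  obtain t1 where t1: "\<And>t. t \<le> t1 \<Longrightarrow> f t \<in> Ua"
    using topological_tendstoD[OF a \<open>open Ua\<close> U(2)] unfolding eventually_at_bot_linorder by metis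
  obtain t2 where t2: "\<And>t. t \<ge> t2 \<Longrightarrow> f t \<in> Ub"
    using topological_tendstoD[OF b \<open>open Ub\<close> U(4)] unfolding eventually_at_top_linorder by metis
  have "compact (f ` {t1..t2})"
    by (intro compact_continuous_image continuous_on_subset[OF cont]) auto
  then obtain C' where C': "C' \<subseteq> C" "finite C'" "f ` {t1..t2} \<subseteq> \<Union>C'"
    using op cov by (elim compactE[of _ C]) auto
  have "f t \<in> \<Union>(insert Ua (insert Ub C'))" for t
  proof -
    consider "t \<le> t1" | "t2 \<le> t" | "t \<in> {t1..t2}" by fastforce
    then show ?thesis
    proof cases
      case 3
      then have "f t \<in> f ` {t1..t2}" by (rule imageI)
      then show ?thesis using C'(3) by auto
    qed (use t1 t2 in auto)
  qed
  then show "\<exists>C'\<subseteq>C. finite C' \<and> insert a (insert b (range f)) \<subseteq> \<Union>C'"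
    using C' U by (intro exI[of _ "insert Ua (insert Ub C')"]) blast
qed

lemma connected_lower_half_plane: "connected {z :: real \<times> real. snd z < 0}"
proof -
  have "{z :: real \<times> real. snd z < 0} = UNIV \<times> {..<0}" by auto
  then show ?thesis by (simp add: connected_Times)
qed

lemma unbounded_lower_half_plane: "\<not> bounded {z :: real \<times> real. snd z < 0}"
proof
  assume "bounded {z :: real \<times> real. snd z < 0}"
  then obtain B where B: "\<And>z :: real \<times> real. snd z < 0 \<Longrightarrow> norm z \<le> B"
    unfolding bounded_iff mem_Collect_eq Ball_def by metis
  have "\<bar>B\<bar> + 1 \<le> norm (\<bar>B\<bar> + 1, -1 :: real)"
    using norm_fst_le[of "\<bar>B\<bar> + 1" "-1 :: real"] by simp
  then show False using B[of "(\<bar>B\<bar> + 1, -1)"] by auto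
qed

text \<open>A bounded component of the complement of a subset of the closed upper half plane lies in the
  open upper half plane, so adding points of the axis does not affect it.\<close>

lemma no_bounded_component:
  fixes S T :: "(real \<times> real) set"
  assumes S: "S \<subseteq> UNIV \<times> {0..}" "closed S" and T: "S \<subseteq> T" "T \<subseteq> S \<union> UNIV \<times> {0}"
    and "bounded T" "connected (- T)" and D: "D \<in> components (- S)" 
  shows "\<not> bounded D"
proof
  assume "bounded D"
  have DS: "D \<subseteq> - S" "D \<noteq> {}" using D in_components_subset in_components_nonempty by auto
  have "open D" using D S(2) open_components[of "- S"] by auto
  have max: "C \<subseteq> D" if "connected C" "C \<subseteq> - S" "C \<inter> D \<noteq> {}" for C
    using components_maximal[OF D that(1,2)] that(3) by auto
  have nn: "0 \<le> snd z" if "z \<in> D" for z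
  proof (rule ccontr)
    assume "\<not> 0 \<le> snd z"
    then have "{z :: real \<times> real. snd z < 0} \<subseteq> D"
    proof (intro max connected_lower_half_plane)
      show "{z. snd z < 0} \<subseteq> - S" using S(1) by force
      show "{z. snd z < 0} \<inter> D \<noteq> {}" using that \<open>\<not> 0 \<le> snd z\<close> by (metis (mono_tags, lifting) IntI emptyE mem_Collect_eq not_le)
    qed
    then show False using \<open>bounded D\<close> unbounded_lower_half_plane bounded_subset by blast
  qed
  \<comment> \<open>\<open>D\<close> is open, so with a point on the axis it would also contain
    points below the axis.\<close>
  have pos: "0 < snd z" if z: "z \<in> D" for z
  proof -
    obtain e where e: "e > 0" "ball z e \<subseteq> D"
      using \<open>open D\<close> z by (meson open_contains_ball)
    have "(fst z, snd z - e / 2) \<in> ball z e"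
      using e by (cases z) (auto simp: dist_prod_def dist_real_def)
    then have "0 \<le> snd z - e / 2" using nn[of "(fst z, snd z - e / 2)"] e by auto
    then show ?thesis using e by auto
  qed
  have "D \<subseteq> - T" using DS(1) T(2) pos by fastforce
  \<comment> \<open>\<open>D\<close> misses \<open>T\<close> too, so the connected set
    \<open>- T\<close> meets \<open>D\<close> and is swallowed by it. The plane would then be the
    union of the bounded sets \<open>T\<close> and \<open>D\<close>.\<close>
  then have "- T \<subseteq> D" using DS(2) T(1) by (intro max \<open>connected (- T)\<close>) auto
  then have "bounded (- T)" using \<open>bounded D\<close> bounded_subset by blast
  then have "bounded (UNIV :: (real \<times> real) set)"
    using \<open>bounded T\<close> by (metis Compl_partition bounded_Un)
  then show False by simp
qed

section \<open>The planar system and its Lyapunov function\<close>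

locale planar_system =
  fixes N p s \<mu> q \<nu>m \<nu>p :: real
  assumes p_gt_1: "1 < p" and p_less_N: "p < N" and s_gt: "- p < s" and q_gt: "p - 1 < q"
    and roots: "0 < \<nu>m" "\<nu>m < \<nu>p" "h N p \<nu>m = \<mu>" "h N p \<nu>p = \<mu>"
begin

abbreviation "k \<equiv> q - p + 1"

definition "g = gamma_star p s q"

definition "c = N - p - p * g"

definition "F x Y = x powr (2 - p) / (p - 1) * (\<mu> + Y - h N p x)"

definition "G x Y = k * Y * (g - x)"

definition "dh x = (p - 1) * x powr (p - 2) * (N - p - p * x)"

lemma field_eq: "field N p s \<mu> q (x, Y) = (F x Y, G x Y)"
  by (simp add: field_def F_def G_def g_def)

lemma k_pos: "0 < k" and g_pos: "0 < g" and k_g: "k * g = p + s"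
  using p_gt_1 s_gt q_gt by (auto simp: g_def gamma_star_def)

lemma powr_reduce:
  assumes "0 < x"
  shows "x powr (p - 1) = x * x powr (p - 2)" "x powr p = x * x * x powr (p - 2)"
    "x powr (2 - p) = 1 / x powr (p - 2)"
  using assms powr_add[of x 1 "p - 2"] powr_add[of x 2 "p - 2"] powr_minus_divide[of x "p - 2"]
  by (simp_all add: power2_eq_square)

section \<open>Shape of \<open>h\<close> and location of the equilibria\<close>

lemma h_derivative [derivative_intros]:
  assumes "0 < x"
  shows "(h N p has_real_derivative dh x) (at x)"
proof -
  have "((\<lambda>x. x powr (p - 1) * (N - p - (p - 1) * x)) has_real_derivative dh x) (at x)"
    by (rule derivative_eq_intros assms refl)+
      (use assms in \<open>simp add: powr_reduce dh_def algebra_simps\<close>)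
  then show ?thesis by (simp add: h_def[abs_def])
qed

text \<open>Rolle's theorem: the only positive zero of \<open>dh\<close> is
  \<open>(N - p) / p\<close>, so equal values of \<open>h\<close> are taken on opposite sides of
  it.\<close>

lemma critical_between:
  assumes "0 < x" "x < y" "h N p x = h N p y"
  shows "x < (N - p) / p" "(N - p) / p < y"
proof -
  have "\<exists>z>x. z < y \<and> h N p y - h N p x = (y - x) * dh z"
    using assms by (intro MVT2 h_derivative) auto
  then obtain z where z: "x < z" "z < y" "dh z = 0" using assms by auto
  then have "z = (N - p) / p"
    using assms p_gt_1 by (auto simp: dh_def eq_divide_eq mult.commute)
  with z show "x < (N - p) / p" "(N - p) / p < y" by auto
qed

text \<open>Of three distinct solutions two would lie on the same side of the critical
  point.\<close>

lemma h_eq_iff: "0 < x \<Longrightarrow> h N p x = \<mu> \<longleftrightarrow> x = \<nu>m \<or> x = \<nu>p"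
  using critical_between[of x \<nu>m] critical_between[of x \<nu>p] critical_between[of \<nu>m x]
    critical_between[of \<nu>p x] critical_between[of \<nu>m \<nu>p] roots
  by (smt (verit))

text \<open>At an axis equilibrium the sign of the \<open>x\<close>-derivative of \<open>F\<close>
  is opposite to that of \<open>dh\<close>, and \<open>Y\<close> grows or decays according to the
  sign of \<open>g - x\<close>. Equal signs of \<open>dh\<close> and \<open>g - x\<close> there make
  a saddle.\<close>

lemma dh_roots: "0 < dh \<nu>m" "dh \<nu>p < 0"
  using critical_between[of \<nu>m \<nu>p] roots p_gt_1
  by (auto simp: dh_def less_divide_eq divide_less_eq mult.commute zero_less_mult_iff mult_less_0_iff)

text \<open>\<open>h\<close> increases up to \<open>\<nu>m\<close> and decreases from
  \<open>\<nu>p\<close> on. Applied to \<open>g\<close>, this makes both axis equilibria saddles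
  whenever the interior equilibrium exists.\<close>

lemma between_roots:
  assumes "0 < x" "\<mu> < h N p x"
  shows "\<nu>m < x" "x < \<nu>p"
proof -
  note m = critical_between[of \<nu>m \<nu>p]
  show "\<nu>m < x"
  proof (rule ccontr)
    assume x: "\<not> \<nu>m < x"
    have "h N p x \<le> h N p \<nu>m"
    proof (rule DERIV_nonneg_imp_nondecreasing[where f = "h N p"])
      fix y assume y: "x \<le> y" "y \<le> \<nu>m"
      then have "y \<le> (N - p) / p" using m roots by linarith
      then have "p * y \<le> N - p" using p_gt_1 by (simp add: le_divide_eq mult.commute)
      then show "\<exists>d. (h N p has_real_derivative d) (at y) \<and> 0 \<le> d"
        using h_derivative[of y] y assms p_gt_1 by (auto simp: dh_def intro!: exI[of _ "dh y"])
    qed (use x in simp)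
    then show False using assms roots by simp
  qed
  show "x < \<nu>p"
  proof (rule ccontr)
    assume x: "\<not> x < \<nu>p"
    have "h N p x \<le> h N p \<nu>p"
    proof (rule DERIV_nonpos_imp_nonincreasing[where f = "h N p"])
      fix y assume y: "\<nu>p \<le> y" "y \<le> x"
      then have "(N - p) / p \<le> y" using m roots by linarith
      then have "N - p \<le> p * y" using p_gt_1 by (simp add: divide_le_eq mult.commute)
      then show "\<exists>d. (h N p has_real_derivative d) (at y) \<and> d \<le> 0"
        using h_derivative[of y] y roots p_gt_1
        by (auto simp: dh_def mult_le_0_iff intro!: exI[of _ "dh y"])
    qed (use x in simp)
    then show False using assms roots by simp
  qed
qed

lemma equilibrium_iff:
  assumes "0 < x"
  shows "F x Y = 0 \<and> G x Y = 0 \<longleftrightarrow>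
    Y = 0 \<and> (x = \<nu>m \<or> x = \<nu>p) \<or> x = g \<and> Y = h N p g - \<mu>"
  using assms k_pos h_eq_iff[OF assms] p_gt_1 by (auto simp: F_def G_def)

text \<open>\<open>P\<close> is chosen so that the terms in \<open>Y\<close> cancel in the derivative of \<open>V\<close> along the flow, which
  becomes \<open>- c * W\<close>.\<close>

definition "P x = (p - 1) / p * x powr p - g * x powr (p - 1) + (\<mu> - c * g powr (p - 1)) / p"

definition "V x Y = Y powr (p / k) * (P x + Y / (q + 1))"

definition "W x Y = Y powr (p / k) * ((x - g) * (x powr (p - 1) - g powr (p - 1)))"

lemma P_derivative:
  assumes "0 < x"
  shows "(P has_real_derivative (p - 1) * x powr (p - 2) * (x - g)) (at x)"
proof -
  have "((\<lambda>x. (p - 1) / p * x powr p - g * x powr (p - 1) + (\<mu> - c * g powr (p - 1)) / p)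
    has_real_derivative (p - 1) * x powr (p - 2) * (x - g)) (at x)"
    by (rule derivative_eq_intros assms refl)+
      (use assms p_gt_1 in \<open>simp add: powr_reduce field_simps\<close>)
  then show ?thesis by (simp add: P_def[abs_def])
qed

lemma P_h: "0 < x \<Longrightarrow> p * P x = \<mu> - h N p x + c * (x powr (p - 1) - g powr (p - 1))"
  using p_gt_1 by (simp add: P_def h_def c_def powr_reduce field_simps)

lemma P_g: "p * P g = \<mu> - h N p g"
  using P_h[OF g_pos] by simp

lemma F_powr: "0 < x \<Longrightarrow> (p - 1) * x powr (p - 2) * F x Y = \<mu> + Y - h N p x"
  using p_gt_1 by (simp add: F_def powr_reduce)

text \<open>The factor \<open>\<sigma> = -1\<close> reverses time.\<close>

definition "flow \<sigma> T x Y \<longleftrightarrow> (\<forall>t\<in>T.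
   (x has_real_derivative \<sigma> * F (x t) (Y t)) (at t) \<and>
   (Y has_real_derivative \<sigma> * G (x t) (Y t)) (at t))"

lemma flow_continuous: "flow \<sigma> T x Y \<Longrightarrow> A \<subseteq> T \<Longrightarrow> continuous_on A x \<and> continuous_on A Y"
  unfolding flow_def by (meson DERIV_isCont continuous_at_imp_continuous_on subsetD)

lemma V_flow:
  assumes "flow \<sigma> T x Y" "t \<in> T" "0 < x t" "0 < Y t"
  shows "((\<lambda>t. V (x t) (Y t)) has_real_derivative - \<sigma> * c * W (x t) (Y t)) (at t)"
proof -
  have x': "(x has_real_derivative \<sigma> * F (x t) (Y t)) (at t)"
    and Y': "(Y has_real_derivative \<sigma> * G (x t) (Y t)) (at t)"
    using assms by (auto simp: flow_def)
  define y where "y = Y t powr (p / k)"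
  have y: "Y t powr (p / k - 1) * Y t = y"
    using assms(4) by (simp add: powr_diff y_def)
  have "((\<lambda>t. V (x t) (Y t)) has_real_derivative
     (p / k * Y t powr (p / k - 1) * (\<sigma> * G (x t) (Y t))) * (P (x t) + Y t / (q + 1)) +
     ((p - 1) * x t powr (p - 2) * (x t - g) * (\<sigma> * F (x t) (Y t)) + \<sigma> * G (x t) (Y t) / (q + 1)) * y) (at t)"
    unfolding V_def y_def
    by (rule derivative_eq_intros DERIV_chain2[OF P_derivative] x' Y' assms(3,4) refl DERIV_cdivide)+
      (use q_gt p_gt_1 in auto)
  also have "(p / k * Y t powr (p / k - 1) * (\<sigma> * G (x t) (Y t))) =
     p * \<sigma> * (g - x t) * (Y t powr (p / k - 1) * Y t)"
    using k_pos by (simp add: G_def field_simps)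
  also have "\<dots> = p * \<sigma> * (g - x t) * y" unfolding y ..
  also have "(p - 1) * x t powr (p - 2) * (x t - g) * (\<sigma> * F (x t) (Y t)) =
     \<sigma> * (x t - g) * (\<mu> + Y t - h N p (x t))"
    unfolding F_powr[OF assms(3), symmetric] by simp
  also have "p * \<sigma> * (g - x t) * y * (P (x t) + Y t / (q + 1)) +
      (\<sigma> * (x t - g) * (\<mu> + Y t - h N p (x t)) + \<sigma> * G (x t) (Y t) / (q + 1)) * y =
     \<sigma> * (g - x t) * y * (p * P (x t) + (p + k) * (Y t / (q + 1)) - (\<mu> + Y t - h N p (x t)))"
  proof -
    define Z where "Z = Y t / (q + 1)"
    have Y: "Y t = (q + 1) * Z" and G: "\<sigma> * G (x t) (Y t) / (q + 1) = \<sigma> * k * Z * (g - x t)"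
      using q_gt p_gt_1 by (auto simp: Z_def G_def)
    show ?thesis unfolding G unfolding Z_def[symmetric] unfolding Y by (simp add: algebra_simps)
  qed
  \<comment> \<open>Since \<open>p + k = q + 1\<close>, the terms in \<open>Y\<close> cancel;
    \<open>P_h\<close> evaluates what remains.\<close>
  also have "\<dots> = \<sigma> * (g - x t) * y * (c * (x t powr (p - 1) - g powr (p - 1)))"
    unfolding P_h[OF assms(3)] using q_gt p_gt_1 by simp
  also have "\<dots> = - \<sigma> * c * W (x t) (Y t)" by (simp add: W_def y_def algebra_simps)
  finally show ?thesis .
qed

text \<open>\<open>x powr (p - 1)\<close> increases with \<open>x\<close>, so both differences in
  \<open>W\<close> have the sign of \<open>x - g\<close>.\<close>

lemma W_nonneg: "0 < x \<Longrightarrow> 0 \<le> W x Y"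
  using powr_mono2[of "p - 1" x g] powr_mono2[of "p - 1" g x] g_pos p_gt_1
  unfolding W_def by (cases "x \<le> g") (auto intro!: mult_nonneg_nonneg simp: zero_le_mult_iff)

lemma W_eq_0_iff: "0 < x \<Longrightarrow> 0 < Y \<Longrightarrow> W x Y = 0 \<longleftrightarrow> x = g"
  using powr_less_mono2[of "p - 1" x g] powr_less_mono2[of "p - 1" g x] g_pos p_gt_1
  unfolding W_def by (cases x g rule: linorder_cases) auto

lemma V_axis: "V x 0 = 0"
  by (simp add: V_def)

text \<open>Here \<open>P g\<close> is \<open>- Y / p\<close>, and \<open>p < q + 1\<close>. As
  \<open>V\<close> is \<open>0\<close> on the axis, its values tell the two kinds of equilibria
  apart.\<close>

lemma V_interior_equilibrium: 
  assumes "\<mu> < h N p g" shows "V g (h N p g - \<mu>) < 0"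
proof -
  let ?Y = "h N p g - \<mu>"
  have "P g = - (?Y / p)" using P_g p_gt_1 by (simp add: field_simps)
  moreover have "?Y / (q + 1) < ?Y / p"
    using assms q_gt p_gt_1 by (intro divide_strict_left_mono) auto
  ultimately have "P g + ?Y / (q + 1) < 0" by linarith
  then show ?thesis unfolding V_def using assms by (intro mult_pos_neg) auto
qed

lemma V_tendsto:
  assumes "(x \<longlongrightarrow> x0) A" "(Y \<longlongrightarrow> Y0) A" "0 < x0" "eventually (\<lambda>t. 0 \<le> Y t) A"
  shows "((\<lambda>t. V (x t) (Y t)) \<longlongrightarrow> V x0 Y0) A"
  unfolding V_def P_def using assms k_pos p_gt_1
  by (intro tendsto_intros) auto

lemma h_continuous_on: "\<forall>z\<in>A. 0 < f z \<Longrightarrow> continuous_on A f \<Longrightarrow> continuous_on A (\<lambda>z. h N p (f z))"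
  unfolding h_def by (intro continuous_intros) auto

lemma V_continuous_on: "continuous_on ({0<..} \<times> {0..}) (\<lambda>z. V (fst z) (snd z))"
  unfolding V_def P_def using k_pos p_gt_1
  by (intro continuous_intros continuous_on_powr') auto

lemma W_continuous_on: "continuous_on ({0<..} \<times> {0..}) (\<lambda>z. W (fst z) (snd z))"
  unfolding W_def using k_pos p_gt_1
  by (intro continuous_intros continuous_on_powr') auto

lemma F_continuous_on: "continuous_on ({0<..} \<times> UNIV) (\<lambda>z. F (fst z) (snd z))"
  unfolding F_def using p_gt_1
  by (intro continuous_intros h_continuous_on) auto

lemma F_tendsto:
  assumes "(x \<longlongrightarrow> x0) A" "(Y \<longlongrightarrow> Y0) A" "0 < x0"
  shows "((\<lambda>t. F (x t) (Y t)) \<longlongrightarrow> F x0 Y0) A"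
  unfolding F_def h_def using assms p_gt_1
  by (intro tendsto_intros) auto

text \<open>Where \<open>V\<close> is stationary \<open>x = g\<close>, and then \<open>x' = 0\<close> determines \<open>Y\<close>.\<close>

lemma V_repeat_imp_equilibrium:
  assumes fl: "flow \<sigma> T x Y" and T: "{a..b} \<subseteq> T" and pos: "\<And>t. t \<in> T \<Longrightarrow> 0 < x t \<and> 0 < Y t"
    and "a < b" "V (x a) (Y a) = V (x b) (Y b)" "\<sigma> * c \<noteq> 0" "t \<in> {a..b}"
  shows "x t = g \<and> Y t = h N p g - \<mu>"
proof -
  have V': "((\<lambda>t. V (x t) (Y t)) has_real_derivative - (\<sigma> * c) * W (x t) (Y t)) (at t)" if "t \<in> T" for t
    using V_flow[OF fl that] pos[OF that] by simp
  \<comment> \<open>The factor \<open>\<sigma> * c\<close> turns the derivative into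
    \<open>- (\<sigma> * c)\<^sup>2 * W\<close>, so both signs of \<open>c\<close> are handled at
    once.\<close>
  have mono: "\<sigma> * c * V (x u) (Y u) \<ge> \<sigma> * c * V (x v) (Y v)" if "a \<le> u" "u \<le> v" "v \<le> b" for u v
  proof (rule DERIV_nonpos_imp_nonincreasing[OF that(2)])
    fix t assume "u \<le> t" "t \<le> v"
    then have t: "t \<in> T" using that T by auto
    have "((\<lambda>t. \<sigma> * c * V (x t) (Y t)) has_real_derivative - ((\<sigma> * c)\<^sup>2 * W (x t) (Y t))) (at t)"
      by (rule DERIV_cong[OF DERIV_cmult[OF V'[OF t]]]) (simp add: power2_eq_square)
    moreover have "- ((\<sigma> * c)\<^sup>2 * W (x t) (Y t)) \<le> 0"
      using W_nonneg[of "x t" "Y t"] pos[OF t] by simp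
    ultimately show "\<exists>d. ((\<lambda>t. \<sigma> * c * V (x t) (Y t)) has_real_derivative d) (at t) \<and> d \<le> 0"
      by blast
  qed
  define v where "v = V (x a) (Y a)"
  have const: "V (x u) (Y u) = v" if "u \<in> {a..b}" for u
    using mono[of a u] mono[of u b] that assms(5,6) \<open>a < b\<close> by (auto simp: v_def)
  have xg: "x u = g" if "u \<in> {a<..<b}" for u
  proof -
    have "u \<in> T" using that T by auto
    have "((\<lambda>t. V (x t) (Y t)) has_real_derivative 0) (at u)"
      by (rule has_field_derivative_transform_within_open[of "\<lambda>_. v" 0 _ "{a<..<b}"])
         (use that const in auto)
    then have "- (\<sigma> * c) * W (x u) (Y u) = 0"
      using DERIV_unique[OF V'[OF \<open>u \<in> T\<close>]] by blast
    then have "W (x u) (Y u) = 0" using assms(6) by simp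
    then show ?thesis using W_eq_0_iff pos[OF \<open>u \<in> T\<close>] by auto
  qed
  have eqm: "Y u = h N p g - \<mu>" if "u \<in> {a<..<b}" for u
  proof -
    have "u \<in> T" using that T by auto
    have "(x has_real_derivative 0) (at u)"
      by (rule has_field_derivative_transform_within_open[of "\<lambda>_. g" 0 _ "{a<..<b}"]) (use that xg in auto)
    moreover have "(x has_real_derivative \<sigma> * F (x u) (Y u)) (at u)"
      using fl \<open>u \<in> T\<close> by (auto simp: flow_def)
    ultimately have "\<sigma> * F (x u) (Y u) = 0" using DERIV_unique by blast
    then show ?thesis
      using assms(6) F_powr[of "x u" "Y u"] pos[OF \<open>u \<in> T\<close>] xg[OF that] by auto
  qed
  have "continuous_on {a..b} x" "continuous_on {a..b} Y"
    using flow_continuous[OF fl T] by auto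
  \<comment> \<open>Derivatives gave the result only on the open interval. A sum of squares carries
    both equations to the end points by continuity.\<close>
  then have "continuous_on {a..b} (\<lambda>t. (x t - g)\<^sup>2 + (Y t - (h N p g - \<mu>))\<^sup>2)"
    by (intro continuous_intros)
  then have "(x t - g)\<^sup>2 + (Y t - (h N p g - \<mu>))\<^sup>2 = 0"
    by (rule continuous_constant_on_closure[of "{a<..<b}", unfolded closure_greaterThanLessThan[OF \<open>a < b\<close>]])
      (use xg eqm assms(7) in auto)
  then show ?thesis by (simp add: sum_power2_eq_zero_iff)
qed

end

section \<open>Uniqueness of orbits\<close>

lemma C1_lipschitz:
  fixes f f' :: "real \<Rightarrow> real"
  assumes f': "\<And>x. x \<in> {a..b} \<Longrightarrow> (f has_real_derivative f' x) (at x)" and "continuous_on {a..b} f'"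
  shows "\<exists>L\<ge>0. \<forall>x\<in>{a..b}. \<forall>y\<in>{a..b}. \<bar>f x - f y\<bar> \<le> L * \<bar>x - y\<bar>"
proof -
  have "bounded (f' ` {a..b})"
    using assms(2) by (intro compact_imp_bounded compact_continuous_image) auto
  then obtain L where L: "0 < L" "\<And>x. x \<in> {a..b} \<Longrightarrow> \<bar>f' x\<bar> \<le> L"
    unfolding bounded_pos by auto
  have "norm (f x - f y) \<le> L * norm (x - y)" if "x \<in> {a..b}" "y \<in> {a..b}" for x y
    using that f' L(2)
    by (intro field_differentiable_bound[of "{a..b}" f f']) (auto intro: has_field_derivative_at_within)
  then show ?thesis using L by (intro exI[of _ L]) (auto simp del: atLeastAtMost_iff)
qed

context planar_system
begin

text \<open>\<open>Y\<close> solves a linear equation whose coefficient is bounded on compact time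
  intervals, so Gronwall applies to \<open>Y\<^sup>2\<close>. In the closed upper half plane an
  orbit thus either lies in the axis or never meets it.\<close>

lemma flow_stays_on_axis:
  assumes fl: "flow \<sigma> T x Y" and "is_interval T" and t: "a \<in> T" "t \<in> T" and "Y a = 0"
  shows "Y t = 0"
proof -
  define l b where "l = min a t" and "b = max a t"
  have sub: "{l..b} \<subseteq> T"
    using mem_is_interval_1_I[OF \<open>is_interval T\<close> t] mem_is_interval_1_I[OF \<open>is_interval T\<close> t(2,1)]
    by (cases "a \<le> t") (auto simp: l_def b_def)
  have "bounded (x ` {l..b})"
    using flow_continuous[OF fl sub] by (intro compact_imp_bounded compact_continuous_image) auto
  then obtain M where M: "\<And>u. u \<in> {l..b} \<Longrightarrow> \<bar>x u\<bar> \<le> M"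
    unfolding bounded_iff by (auto simp del: atLeastAtMost_iff)
  have "(Y t)\<^sup>2 = 0"
  proof (rule gronwall_zero[where w = "\<lambda>u. (Y u)\<^sup>2" and L = "2 * \<bar>\<sigma>\<bar> * k * (g + M)" and c = a])
    fix u assume u: "u \<in> {l..b}"
    then have Y': "(Y has_real_derivative \<sigma> * G (x u) (Y u)) (at u)" using fl sub by (auto simp: flow_def)
    show "((\<lambda>u. (Y u)\<^sup>2) has_real_derivative 2 * \<sigma> * k * (g - x u) * (Y u)\<^sup>2) (at u)"
      by (rule derivative_eq_intros Y' refl)+ (simp add: G_def power2_eq_square algebra_simps)
    have "\<bar>g - x u\<bar> \<le> g + M" using M[OF u] g_pos by linarith
    then have "2 * \<bar>\<sigma>\<bar> * k * \<bar>g - x u\<bar> \<le> 2 * \<bar>\<sigma>\<bar> * k * (g + M)"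
      using k_pos by (intro mult_left_mono) auto
    then have "2 * \<bar>\<sigma>\<bar> * k * \<bar>g - x u\<bar> * (Y u)\<^sup>2 \<le> 2 * \<bar>\<sigma>\<bar> * k * (g + M) * (Y u)\<^sup>2"
      by (rule mult_right_mono) simp
    then show "\<bar>2 * \<sigma> * k * (g - x u) * (Y u)\<^sup>2\<bar> \<le> 2 * \<bar>\<sigma>\<bar> * k * (g + M) * (Y u)\<^sup>2"
      using k_pos by (simp add: abs_mult)
  qed (use \<open>Y a = 0\<close> in \<open>auto simp: l_def b_def\<close>)
  then show ?thesis by simp
qed

text \<open>\<open>F\<close> is affine in \<open>Y\<close> with coefficients that are continuously
  differentiable in \<open>x > 0\<close>, so one-variable estimates for the two coefficients
  suffice.\<close>

lemma F_lipschitz: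
  assumes "0 < lo"
  obtains L where "0 \<le> L" "\<And>x x' Y Y'. x \<in> {lo..hi} \<Longrightarrow> x' \<in> {lo..hi} \<Longrightarrow> \<bar>Y\<bar> \<le> M \<Longrightarrow> \<bar>Y'\<bar> \<le> M \<Longrightarrow>
    \<bar>F x Y - F x' Y'\<bar> \<le> L * (\<bar>x - x'\<bar> + \<bar>Y - Y'\<bar>)"
proof -
  define A where "A x = x powr (2 - p) * (\<mu> - h N p x)" for x
  define B where "B x = x powr (2 - p)" for x :: real
  have F: "F x Y = (A x + B x * Y) / (p - 1)" for x Y
    by (simp add: F_def A_def B_def algebra_simps diff_divide_distrib add_divide_distrib)
  have "(B has_real_derivative (2 - p) * x powr (1 - p)) (at x)" if "x \<in> {lo..hi}" for x
    unfolding B_def[abs_def] by (rule derivative_eq_intros refl)+ (use that assms in auto)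
  moreover have "continuous_on {lo..hi} (\<lambda>x. (2 - p) * x powr (1 - p))"
    using assms by (intro continuous_intros) auto
  ultimately have "\<exists>L\<ge>0. \<forall>x\<in>{lo..hi}. \<forall>y\<in>{lo..hi}. \<bar>B x - B y\<bar> \<le> L * \<bar>x - y\<bar>"
    by (rule C1_lipschitz)
  then obtain LB where LB: "0 \<le> LB"
    "\<And>x y. x \<in> {lo..hi} \<Longrightarrow> y \<in> {lo..hi} \<Longrightarrow> \<bar>B x - B y\<bar> \<le> LB * \<bar>x - y\<bar>"
    by blast
  have "(A has_real_derivative (2 - p) * x powr (1 - p) * (\<mu> - h N p x) - dh x * x powr (2 - p)) (at x)"
    if "x \<in> {lo..hi}" for x
  proof -
    have "0 < x" using that assms by auto
    show ?thesis unfolding A_def[abs_def] by (rule derivative_eq_intros refl \<open>0 < x\<close>)+ simp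
  qed
  moreover have "continuous_on {lo..hi}
      (\<lambda>x. (2 - p) * x powr (1 - p) * (\<mu> - h N p x) - dh x * x powr (2 - p))"
    using assms unfolding dh_def by (intro continuous_intros h_continuous_on) auto
  ultimately have "\<exists>L\<ge>0. \<forall>x\<in>{lo..hi}. \<forall>y\<in>{lo..hi}. \<bar>A x - A y\<bar> \<le> L * \<bar>x - y\<bar>"
    by (rule C1_lipschitz)
  then obtain LA where LA: "0 \<le> LA"
    "\<And>x y. x \<in> {lo..hi} \<Longrightarrow> y \<in> {lo..hi} \<Longrightarrow> \<bar>A x - A y\<bar> \<le> LA * \<bar>x - y\<bar>"
    by blast
  have "bounded (B ` {lo..hi})"
    unfolding B_def using assms by (intro compact_imp_bounded compact_continuous_image continuous_intros) auto
  then obtain K where K: "0 < K" "\<And>x. x \<in> {lo..hi} \<Longrightarrow> \<bar>B x\<bar> \<le> K" unfolding bounded_pos by auto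
  have "\<bar>F x Y - F x' Y'\<bar> \<le> ((LA + LB * \<bar>M\<bar> + K) / (p - 1)) * (\<bar>x - x'\<bar> + \<bar>Y - Y'\<bar>)"
    if x: "x \<in> {lo..hi}" "x' \<in> {lo..hi}" and Y: "\<bar>Y\<bar> \<le> M" "\<bar>Y'\<bar> \<le> M" for x x' Y Y'
  proof -
    have "\<bar>(B x - B x') * Y\<bar> \<le> (LB * \<bar>x - x'\<bar>) * \<bar>M\<bar>"
      unfolding abs_mult using LB(2)[OF x] Y by (intro mult_mono) auto
    moreover have "\<bar>B x' * (Y - Y')\<bar> \<le> K * \<bar>Y - Y'\<bar>"
      unfolding abs_mult using K(2)[OF x(2)] by (intro mult_right_mono) auto
    moreover have "0 \<le> LA * \<bar>Y - Y'\<bar>" "0 \<le> LB * \<bar>M\<bar> * \<bar>Y - Y'\<bar>" "0 \<le> K * \<bar>x - x'\<bar>"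
      using LA(1) LB(1) K(1) by auto
    ultimately have "\<bar>(A x - A x') + ((B x - B x') * Y + B x' * (Y - Y'))\<bar>
        \<le> (LA + LB * \<bar>M\<bar> + K) * (\<bar>x - x'\<bar> + \<bar>Y - Y'\<bar>)"
      using LA(2)[OF x] unfolding distrib_left distrib_right by (simp add: mult.commute mult.left_commute) linarith
    moreover have "F x Y - F x' Y' = ((A x - A x') + ((B x - B x') * Y + B x' * (Y - Y'))) / (p - 1)"
      unfolding F by (simp add: algebra_simps diff_divide_distrib add_divide_distrib)
    ultimately show ?thesis using p_gt_1 by (simp add: divide_right_mono)
  qed
  moreover have "0 \<le> (LA + LB * \<bar>M\<bar> + K) / (p - 1)" using LA(1) LB(1) K(1) p_gt_1 by simp
  ultimately show thesis using that by blast
qed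

lemma flow_unique_at_zero:
  assumes fl1: "flow \<sigma> UNIV x1 Y1" and fl2: "flow \<sigma> UNIV x2 Y2"
    and pos: "\<And>t. 0 < x1 t" "\<And>t. 0 < x2 t" and eq: "x1 0 = x2 0" "Y1 0 = Y2 0"
  shows "x1 t = x2 t \<and> Y1 t = Y2 t"
proof -
  define I where "I = {- \<bar>t\<bar>..\<bar>t\<bar>}"
  have I: "compact I" "I \<noteq> {}" by (auto simp: I_def)
  have cont: "continuous_on I x1" "continuous_on I x2" "continuous_on I Y1" "continuous_on I Y2"
    using flow_continuous[OF fl1, of I] flow_continuous[OF fl2, of I] by auto
  obtain lo1 where lo1: "0 < lo1" "\<And>u. u \<in> I \<Longrightarrow> lo1 \<le> x1 u"
    using continuous_attains_inf[OF I cont(1)] pos by metis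
  obtain lo2 where lo2: "0 < lo2" "\<And>u. u \<in> I \<Longrightarrow> lo2 \<le> x2 u"
    using continuous_attains_inf[OF I cont(2)] pos by metis
  obtain hi1 where hi1: "\<And>u. u \<in> I \<Longrightarrow> x1 u \<le> hi1"
    using continuous_attains_sup[OF I cont(1)] by metis
  obtain hi2 where hi2: "\<And>u. u \<in> I \<Longrightarrow> x2 u \<le> hi2"
    using continuous_attains_sup[OF I cont(2)] by metis
  obtain M1 where M1: "\<And>u. u \<in> I \<Longrightarrow> \<bar>Y1 u\<bar> \<le> M1"
    using continuous_attains_sup[OF I, of "\<lambda>u. \<bar>Y1 u\<bar>"] cont by (metis continuous_on_rabs)
  obtain M2 where M2: "\<And>u. u \<in> I \<Longrightarrow> \<bar>Y2 u\<bar> \<le> M2"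
    using continuous_attains_sup[OF I, of "\<lambda>u. \<bar>Y2 u\<bar>"] cont by (metis continuous_on_rabs)
  define lo hi M where "lo = min lo1 lo2" and "hi = max hi1 hi2" and "M = max M1 M2"
  have box: "x1 u \<in> {lo..hi}" "x2 u \<in> {lo..hi}" "\<bar>Y1 u\<bar> \<le> M" "\<bar>Y2 u\<bar> \<le> M" if "u \<in> I" for u
    using lo1(2)[OF that] lo2(2)[OF that] hi1[OF that] hi2[OF that] M1[OF that] M2[OF that]
    by (auto simp: lo_def hi_def M_def)
  have "0 < lo" using lo1 lo2 by (simp add: lo_def)
  then obtain L where L: "0 \<le> L" "\<And>x x' Y Y'. x \<in> {lo..hi} \<Longrightarrow> x' \<in> {lo..hi} \<Longrightarrow> \<bar>Y\<bar> \<le> M \<Longrightarrow> \<bar>Y'\<bar> \<le> M \<Longrightarrow>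
    \<bar>F x Y - F x' Y'\<bar> \<le> L * (\<bar>x - x'\<bar> + \<bar>Y - Y'\<bar>)" using F_lipschitz by metis
  \<comment> \<open>\<open>g + hi + M\<close> dominates both \<open>\<bar>g - x1 u\<bar>\<close> and
    \<open>\<bar>Y2 u\<bar>\<close>, the coefficients that appear when the difference of the values
    of \<open>G\<close> is split.\<close>
  define K where "K = k * (g + hi + M)"
  \<comment> \<open>In the Gronwall constant one factor \<open>2\<close> comes from differentiating
    squares and the other from bounding the square of a sum by twice the sum of the squares.\<close>
  have "(x1 t - x2 t)\<^sup>2 + (Y1 t - Y2 t)\<^sup>2 = 0"
  proof (rule gronwall_zero[where w = "\<lambda>u. (x1 u - x2 u)\<^sup>2 + (Y1 u - Y2 u)\<^sup>2" and t = t and a = "- \<bar>t\<bar>" and b = "\<bar>t\<bar>" and c = 0 and L = "4 * \<bar>\<sigma>\<bar> * (L + K)"])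
    fix u assume "u \<in> {- \<bar>t\<bar>..\<bar>t\<bar>}"
    then have u: "u \<in> I" by (simp add: I_def)
    let ?dx = "x1 u - x2 u" and ?dY = "Y1 u - Y2 u"
    let ?dF = "F (x1 u) (Y1 u) - F (x2 u) (Y2 u)" and ?dG = "G (x1 u) (Y1 u) - G (x2 u) (Y2 u)"
    have d: "(x1 has_real_derivative \<sigma> * F (x1 u) (Y1 u)) (at u)" "(Y1 has_real_derivative \<sigma> * G (x1 u) (Y1 u)) (at u)"
      "(x2 has_real_derivative \<sigma> * F (x2 u) (Y2 u)) (at u)" "(Y2 has_real_derivative \<sigma> * G (x2 u) (Y2 u)) (at u)"
      using fl1 fl2 by (auto simp: flow_def)
    show "((\<lambda>u. (x1 u - x2 u)\<^sup>2 + (Y1 u - Y2 u)\<^sup>2) has_real_derivative 2 * \<sigma> * (?dx * ?dF + ?dY * ?dG)) (at u)"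
      by (rule derivative_eq_intros d refl)+ (simp add: algebra_simps)
    have hM: "0 \<le> hi" "0 \<le> M" using box[OF u] \<open>0 < lo\<close> by auto
    then have "0 \<le> K" using k_pos g_pos by (simp add: K_def)
    have dF: "\<bar>?dF\<bar> \<le> L * (\<bar>?dx\<bar> + \<bar>?dY\<bar>)" using L(2) box[OF u] by blast
    have dG: "\<bar>?dG\<bar> \<le> K * (\<bar>?dx\<bar> + \<bar>?dY\<bar>)"
    proof -
      have "?dG = k * (?dY * (g - x1 u) - Y2 u * ?dx)" by (simp add: G_def algebra_simps)
      then have "\<bar>?dG\<bar> \<le> k * (\<bar>?dY\<bar> * \<bar>g - x1 u\<bar> + \<bar>Y2 u\<bar> * \<bar>?dx\<bar>)"
        using k_pos abs_triangle_ineq4[of "?dY * (g - x1 u)" "Y2 u * ?dx"]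
        by (simp add: abs_mult)
      also have "\<dots> \<le> k * (\<bar>?dY\<bar> * (g + hi + M) + (g + hi + M) * \<bar>?dx\<bar>)"
      proof -
        have "\<bar>g - x1 u\<bar> \<le> g + hi + M" "\<bar>Y2 u\<bar> \<le> g + hi + M"
          using box[OF u] \<open>0 < lo\<close> hM g_pos by auto
        then show ?thesis using k_pos by (intro mult_left_mono add_mono mult_right_mono) auto
      qed
      finally show ?thesis by (simp add: K_def algebra_simps)
    qed
    have "\<bar>?dx * ?dF + ?dY * ?dG\<bar> \<le> \<bar>?dx\<bar> * \<bar>?dF\<bar> + \<bar>?dY\<bar> * \<bar>?dG\<bar>"
      using abs_triangle_ineq[of "?dx * ?dF" "?dY * ?dG"] by (simp add: abs_mult)
    also have "\<dots> \<le> \<bar>?dx\<bar> * (L * (\<bar>?dx\<bar> + \<bar>?dY\<bar>)) + \<bar>?dY\<bar> * (K * (\<bar>?dx\<bar> + \<bar>?dY\<bar>))"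
      using dF dG by (intro add_mono mult_left_mono) auto
    also have "\<dots> \<le> (L + K) * (\<bar>?dx\<bar> + \<bar>?dY\<bar>)\<^sup>2"
    proof -
      have "A * (L * (A + B)) + B * (K * (A + B)) \<le> (L + K) * (A + B)\<^sup>2" if "0 \<le> A" "0 \<le> B" for A B
        using that L(1) \<open>0 \<le> K\<close> by (simp add: power2_eq_square algebra_simps)
      then show ?thesis by simp
    qed
    also have "\<dots> \<le> (L + K) * (2 * (?dx\<^sup>2 + ?dY\<^sup>2))"
    proof (rule mult_left_mono)
      have "(\<bar>A\<bar> + \<bar>B\<bar>)\<^sup>2 \<le> 2 * (A\<^sup>2 + B\<^sup>2)" for A B :: real
        using zero_le_power2[of "\<bar>A\<bar> - \<bar>B\<bar>"] unfolding power2_sum power2_diff by simp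
      then show "(\<bar>?dx\<bar> + \<bar>?dY\<bar>)\<^sup>2 \<le> 2 * (?dx\<^sup>2 + ?dY\<^sup>2)" .
    qed (use L(1) \<open>0 \<le> K\<close> in simp)
    finally have bound: "2 * \<bar>\<sigma>\<bar> * \<bar>?dx * ?dF + ?dY * ?dG\<bar> \<le> 2 * \<bar>\<sigma>\<bar> * ((L + K) * (2 * (?dx\<^sup>2 + ?dY\<^sup>2)))"
      by (rule mult_left_mono) simp
    show "\<bar>2 * \<sigma> * (?dx * ?dF + ?dY * ?dG)\<bar> \<le> 4 * \<bar>\<sigma>\<bar> * (L + K) * (?dx\<^sup>2 + ?dY\<^sup>2)"
    proof -
      have "\<bar>2 * \<sigma> * z\<bar> \<le> 4 * \<bar>\<sigma>\<bar> * (L + K) * w" if "2 * \<bar>\<sigma>\<bar> * \<bar>z\<bar> \<le> 2 * \<bar>\<sigma>\<bar> * ((L + K) * (2 * w))" for z w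
        using that by (simp add: abs_mult mult_ac)
      from this[OF bound] show ?thesis .
    qed
  qed (use eq in auto)
  then show ?thesis by (simp add: sum_power2_eq_zero_iff)
qed

lemma flow_shift: "flow \<sigma> UNIV x Y \<Longrightarrow> flow \<sigma> UNIV (\<lambda>t. x (t + a)) (\<lambda>t. Y (t + a))"
  unfolding flow_def by (auto intro: DERIV_shift[THEN iffD1])

lemma flow_unique:
  assumes "flow \<sigma> UNIV x1 Y1" "flow \<sigma> UNIV x2 Y2"
    and "\<And>t. 0 < x1 t" "\<And>t. 0 < x2 t" and "x1 a = x2 b" "Y1 a = Y2 b"
  shows "range (\<lambda>t. (x1 t, Y1 t)) = range (\<lambda>t. (x2 t, Y2 t))"
proof -
  have eq: "x1 (t + a) = x2 (t + b) \<and> Y1 (t + a) = Y2 (t + b)" for t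
    using flow_unique_at_zero[OF flow_shift[OF assms(1), of a] flow_shift[OF assms(2), of b]] assms(3-) by simp
  show ?thesis
  proof (intro equalityI image_subsetI)
    show "(x1 t, Y1 t) \<in> range (\<lambda>t. (x2 t, Y2 t))" for t
      using eq[of "t - a"] by (intro range_eqI[of _ _ "t - a + b"]) simp
    show "(x2 t, Y2 t) \<in> range (\<lambda>t. (x1 t, Y1 t))" for t
      using eq[of "t - b"] by (intro range_eqI[of _ _ "t - b + a"]) simp
  qed
qed


section \<open>Orbits leaving a saddle, as graphs over \<open>Y\<close>\<close>

text \<open>Up to time \<open>T\<close> the coordinate \<open>Y\<close> increases strictly from its
  limit \<open>0\<close>, so it can replace time as the parameter. The factor
  \<open>\<sigma>\<close> cancels in the slope.\<close>

lemma orbit_graph: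
  assumes fl: "flow \<sigma> UNIV x Y" and pos: "\<And>t. 0 < Y t"
    and incr: "\<And>t. t \<le> T \<Longrightarrow> 0 < \<sigma> * G (x t) (Y t)"
    and lim: "(x \<longlongrightarrow> \<nu>) at_bot" "(Y \<longlongrightarrow> 0) at_bot"
  obtains X where
    "\<And>y. 0 < y \<Longrightarrow> y < Y T \<Longrightarrow> \<exists>t<T. Y t = y \<and> x t = X y"
    "\<And>y. 0 < y \<Longrightarrow> y < Y T \<Longrightarrow> (X has_real_derivative F (X y) y / G (X y) y) (at y)"
    "(X \<longlongrightarrow> \<nu>) (at_right 0)"
proof -
  have x': "(x has_real_derivative \<sigma> * F (x t) (Y t)) (at t)"
    and Y': "(Y has_real_derivative \<sigma> * G (x t) (Y t)) (at t)" for t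
    using fl by (auto simp: flow_def)
  have contY: "continuous_on A Y" for A using flow_continuous[OF fl, of A] by simp
  have less: "Y s < Y t" if "s < t" "t \<le> T" for s t
  proof (rule DERIV_pos_imp_increasing[OF that(1)])
    fix u assume "s \<le> u" "u \<le> t"
    then show "\<exists>d. (Y has_real_derivative d) (at u) \<and> 0 < d"
      using Y'[of u] incr[of u] that(2) by auto
  qed
  have inj: "inj_on Y {..<T}"
    by (rule inj_onI) (metis less lessThan_iff less_imp_le less_irrefl linorder_neqE)
  define \<tau> where "\<tau> = inv_into {..<T} Y"
  have \<tau>: "\<tau> (Y t) = t" if "t < T" for t
    unfolding \<tau>_def using that by (intro inv_into_f_f[OF inj]) auto
  have surj: "\<exists>t<T. Y t = y" if y: "0 < y" "y < Y T" for y
  proof -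
    have "eventually (\<lambda>t. Y t < y) at_bot" using lim(2) y by (intro order_tendstoD)
    then have "eventually (\<lambda>t. Y t < y \<and> t < T) at_bot"
      using eventually_gt_at_bot by (intro eventually_conj) (auto simp: eventually_at_bot_dense)
    then obtain s where s: "Y s < y" "s < T"
      using eventually_happens[of _ "at_bot :: real filter"] by auto
    then obtain t where "s \<le> t" "t \<le> T" "Y t = y"
      using IVT'[of Y s y T] y contY by auto
    then show ?thesis using y by (intro exI[of _ t]) (cases "t = T", auto)
  qed
  define X where "X = x \<circ> \<tau>"
  have X: "\<exists>t<T. Y t = y \<and> x t = X y" if y: "0 < y" "y < Y T" for y
    using surj[OF y] \<tau> by (auto simp: X_def)
  have X': "(X has_real_derivative F (X y) y / G (X y) y) (at y)" if y: "0 < y" "y < Y T" for y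
  proof -
    obtain t where t: "t < T" "Y t = y" using surj[OF y] by auto
    have ne: "\<sigma> * G (x t) (Y t) \<noteq> 0" using incr[of t] t by auto
    have "(*) (\<sigma> * G (x t) (Y t)) \<circ> (*) (inverse (\<sigma> * G (x t) (Y t))) = id"
      using right_inverse[OF ne] by (simp add: fun_eq_iff mult.assoc[symmetric] del: inverse_mult_distrib)
    then have "(\<tau> has_real_derivative inverse (\<sigma> * G (x t) (Y t))) (at (Y t))"
      unfolding has_field_derivative_def
      using t \<tau> contY Y'[unfolded has_field_derivative_def]
      by (intro has_derivative_inverse_strong[of "{..<T}" t Y]) auto
    then have "(\<tau> has_real_derivative inverse (\<sigma> * G (x t) (Y t))) (at y)" using t by simp
    moreover have "(x has_real_derivative \<sigma> * F (x t) (Y t)) (at (\<tau> y))"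
      using x'[of t] \<tau> t by auto
    ultimately have "(X has_real_derivative \<sigma> * F (x t) (Y t) * inverse (\<sigma> * G (x t) (Y t))) (at y)"
      unfolding X_def by (intro DERIV_chain)
    moreover have "\<sigma> * F (x t) (Y t) * inverse (\<sigma> * G (x t) (Y t)) = F (X y) y / G (X y) y"
      using t \<tau> ne by (auto simp: X_def field_simps)
    ultimately show ?thesis by simp
  qed
  have "(X \<longlongrightarrow> \<nu>) (at_right 0)"
  proof (rule tendstoI)
    fix e :: real assume "0 < e"
    then have "eventually (\<lambda>t. dist (x t) \<nu> < e) at_bot" using lim(1) by (intro tendstoD)
    then obtain s where s: "\<And>t. t \<le> s \<Longrightarrow> dist (x t) \<nu> < e" by (auto simp: eventually_at_bot_linorder)
    \<comment> \<open>Points of height below \<open>Y r\<close> are reached only before time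
      \<open>r\<close>, hence before \<open>s\<close>, where \<open>x\<close> is already close to
      \<open>\<nu>\<close>.\<close>
    define r where "r = min s T"
    show "eventually (\<lambda>y. dist (X y) \<nu> < e) (at_right 0)"
      unfolding eventually_at_right_field
    proof (intro exI conjI allI impI)
      show "0 < Y r" by (rule pos)
      fix y assume y: "0 < y" "y < Y r"
      moreover have "Y r \<le> Y T" using less[of r T] by (cases "s < T") (auto simp: r_def min_def)
      ultimately obtain t where t: "t < T" "Y t = y" "x t = X y" using X[of y] by auto
      have "t \<le> s"
        using less[of r t] t y by (cases "s \<le> T") (auto simp: r_def not_le[symmetric])
      then show "dist (X y) \<nu> < e" using s t by metis
    qed
  qed
  with X X' show thesis by (rule that)
qed

text \<open>A slope that does not increase in its first argument keeps the squared gap from growing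
  with \<open>y\<close>. The gap tends to \<open>0\<close> at \<open>y = 0\<close>, so it is zero at
  a small height. Nothing is required of \<open>\<rho>\<close> at \<open>y = 0\<close> itself, and
  one common point is enough to identify two orbits.\<close>

lemma graphs_meet:
  fixes \<rho> :: "real \<Rightarrow> real \<Rightarrow> real"
  assumes X1: "\<And>y. 0 < y \<Longrightarrow> y < b \<Longrightarrow> (X1 has_real_derivative \<rho> (X1 y) y) (at y)"
    and X2: "\<And>y. 0 < y \<Longrightarrow> y < b \<Longrightarrow> (X2 has_real_derivative \<rho> (X2 y) y) (at y)"
    and lim: "(X1 \<longlongrightarrow> \<nu>) (at_right 0)" "(X2 \<longlongrightarrow> \<nu>) (at_right 0)" and "0 < b" "0 < r"
    and anti: "\<And>u v y. \<bar>u - \<nu>\<bar> < r \<Longrightarrow> \<bar>v - \<nu>\<bar> < r \<Longrightarrow> u < v \<Longrightarrow> 0 < y \<Longrightarrow> y < r \<Longrightarrow> \<rho> v y \<le> \<rho> u y"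
  obtains y where "0 < y" "y < b" "X1 y = X2 y"
proof -
  have "eventually (\<lambda>y. dist (X1 y) \<nu> < r \<and> dist (X2 y) \<nu> < r) (at_right 0)"
    using lim \<open>0 < r\<close> by (intro eventually_conj tendstoD)
  then obtain d where d: "0 < d" "\<And>y. 0 < y \<Longrightarrow> y < d \<Longrightarrow> \<bar>X1 y - \<nu>\<bar> < r \<and> \<bar>X2 y - \<nu>\<bar> < r"
    by (auto simp: eventually_at_right_field dist_real_def)
  define z where "z = Min {d, b, r} / 2"
  have z: "0 < z" "z < d" "z < b" "z < r"
    using d(1) \<open>0 < b\<close> \<open>0 < r\<close> by (auto simp: z_def min_def)
  have mono: "(X1 z - X2 z)\<^sup>2 \<le> (X1 y - X2 y)\<^sup>2" if y: "0 < y" "y < z" for y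
  proof (rule DERIV_nonpos_imp_nonincreasing[where f = "\<lambda>y. (X1 y - X2 y)\<^sup>2"])
    fix u assume u: "y \<le> u" "u \<le> z"
    have "((\<lambda>y. (X1 y - X2 y)\<^sup>2) has_real_derivative
        2 * ((X1 u - X2 u) * (\<rho> (X1 u) u - \<rho> (X2 u) u))) (at u)"
      using u y z by (auto intro!: derivative_eq_intros X1 X2)
    moreover have "(X1 u - X2 u) * (\<rho> (X1 u) u - \<rho> (X2 u) u) \<le> 0"
      using anti[of "X1 u" "X2 u" u] anti[of "X2 u" "X1 u" u] d(2)[of u] u y z
      by (cases "X1 u" "X2 u" rule: linorder_cases) (auto simp: mult_le_0_iff)
    ultimately show "\<exists>d. ((\<lambda>y. (X1 y - X2 y)\<^sup>2) has_real_derivative d) (at u) \<and> d \<le> 0" by force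
  qed (use y in simp)
  have "((\<lambda>y. (X1 y - X2 y)\<^sup>2) \<longlongrightarrow> (\<nu> - \<nu>)\<^sup>2) (at_right 0)"
    using lim by (intro tendsto_intros)
  then have "(X1 z - X2 z)\<^sup>2 \<le> (\<nu> - \<nu>)\<^sup>2"
    by (rule tendsto_lowerbound)
      (use mono z in \<open>auto simp: eventually_at_right_field intro!: exI[of _ z]\<close>)
  then have "X1 z = X2 z" by simp
  with z show thesis by (intro that)
qed

text \<open>\<open>F / G\<close> is the slope \<open>dx/dY\<close> of an orbit; it decreases in \<open>x\<close> because the equilibria on
  the axis are saddles.\<close>

lemma slope_antimono:
  assumes \<nu>: "\<nu> = \<nu>m \<and> \<nu> < g \<or> \<nu> = \<nu>p \<and> g < \<nu>"
  obtains r where "0 < r" "\<And>u v y. \<bar>u - \<nu>\<bar> < r \<Longrightarrow> \<bar>v - \<nu>\<bar> < r \<Longrightarrow> u < v \<Longrightarrow> 0 < y \<Longrightarrow> y < r \<Longrightarrow>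
    F v y / G v y \<le> F u y / G u y"
proof -
  \<comment> \<open>Up to the positive factor \<open>1 / ((p - 1) * (k * y))\<close> this is
    \<open>F / G\<close>, but it stays regular at \<open>y = 0\<close>, so the sign of its
    \<open>x\<close>-derivative there extends to a neighbourhood.\<close>
  define m where "m x y = x powr (2 - p) * (\<mu> + y - h N p x) / (g - x)" for x y
  define m' where "m' x y = ((2 - p) * x powr (1 - p) * (\<mu> + y - h N p x) - x powr (2 - p) * dh x) / (g - x)
    + x powr (2 - p) * (\<mu> + y - h N p x) / (g - x)\<^sup>2" for x y
  have m_deriv: "((\<lambda>x. m x y) has_real_derivative m' x y) (at x)" if x: "0 < x" "x \<noteq> g" for x y
    unfolding m_def m'_def
  proof -
    have num: "((\<lambda>x. x powr (2 - p) * (\<mu> + y - h N p x)) has_real_derivative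
      (2 - p) * x powr (1 - p) * (\<mu> + y - h N p x) - x powr (2 - p) * dh x) (at x)"
      by (rule derivative_eq_intros x(1) refl)+ simp
    have den: "((\<lambda>x. g - x) has_real_derivative - 1) (at x)"
      by (rule derivative_eq_intros refl)+ simp
    show "((\<lambda>x. x powr (2 - p) * (\<mu> + y - h N p x) / (g - x)) has_real_derivative
      ((2 - p) * x powr (1 - p) * (\<mu> + y - h N p x) - x powr (2 - p) * dh x) / (g - x)
        + x powr (2 - p) * (\<mu> + y - h N p x) / (g - x)\<^sup>2) (at x)"
      by (rule DERIV_cong[OF DERIV_divide[OF num den]])
        (use x in \<open>auto simp: add_divide_distrib power2_eq_square\<close>)
  qed
  have \<nu>0: "0 < \<nu>" "\<nu> \<noteq> g" "h N p \<nu> = \<mu>" using \<nu> roots by auto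
  have "((\<lambda>z. m' (fst z) (snd z)) \<longlongrightarrow> m' \<nu> 0) (nhds (\<nu>, 0))"
  proof -
    have "((\<lambda>z. m' (x z) (y z)) \<longlongrightarrow> m' \<nu> 0) A"
      if "(x \<longlongrightarrow> \<nu>) A" "(y \<longlongrightarrow> 0) A" for x y :: "real \<times> real \<Rightarrow> real" and A
      unfolding m'_def h_def dh_def using that \<nu>0(1,2) by (intro tendsto_intros) auto
    moreover have "(fst \<longlongrightarrow> \<nu>) (nhds (\<nu>, 0 :: real))" "(snd \<longlongrightarrow> 0) (nhds (\<nu>, 0 :: real))"
      using tendsto_fst[OF filterlim_ident, of "(\<nu>, 0 :: real)"]
        tendsto_snd[OF filterlim_ident, of "(\<nu>, 0 :: real)"] by simp_all
    ultimately show ?thesis .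
  qed
  \<comment> \<open>\<open>\<mu> - h N p \<nu>\<close> vanishes, so only the term with
    \<open>dh \<nu> / (g - \<nu>)\<close> survives; at a saddle this quotient is positive.\<close>
  moreover have "m' \<nu> 0 < 0"
  proof -
    have "0 < dh \<nu> / (g - \<nu>)" using \<nu> dh_roots by (auto intro: divide_neg_neg)
    then have "0 < \<nu> powr (2 - p) * (dh \<nu> / (g - \<nu>))"
      using \<nu>0 by (intro mult_pos_pos) auto
    then show ?thesis using \<nu>0 by (simp add: m'_def)
  qed
  ultimately have "eventually (\<lambda>z. m' (fst z) (snd z) < 0) (nhds (\<nu>, 0))"
    by (rule order_tendstoD)
  then obtain d where d: "0 < d" "\<And>z. dist z (\<nu>, 0) < d \<Longrightarrow> m' (fst z) (snd z) < 0"
    by (auto simp: eventually_nhds_metric)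
  \<comment> \<open>Half of \<open>d\<close> because each coordinate may deviate by
    \<open>r\<close>; the other two bounds keep \<open>x\<close> positive and different from
    \<open>g\<close>.\<close>
  define r where "r = Min {d / 2, \<nu>, \<bar>g - \<nu>\<bar>}"
  have r: "0 < r" "r \<le> d / 2" "r \<le> \<nu>" "r \<le> \<bar>g - \<nu>\<bar>" using d(1) \<nu>0 by (auto simp: r_def min_def)
  have "F v y / G v y \<le> F u y / G u y"
    if uv: "\<bar>u - \<nu>\<bar> < r" "\<bar>v - \<nu>\<bar> < r" "u < v" and y: "0 < y" "y < r" for u v y
  proof -
    have "m v y \<le> m u y"
    proof (rule DERIV_nonpos_imp_nonincreasing[where f = "\<lambda>x. m x y"])
      fix x assume "u \<le> x" "x \<le> v"
      then have x: "\<bar>x - \<nu>\<bar> < r" using uv by auto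
      have "dist (x, y) (\<nu>, 0) \<le> \<bar>x - \<nu>\<bar> + \<bar>y\<bar>"
        unfolding dist_prod_def using sqrt_sum_squares_le_sum_abs[of "x - \<nu>" y] by (simp add: dist_real_def)
      then have "m' x y < 0" using d(2)[of "(x, y)"] x y r by simp
      moreover have "0 < x" "x \<noteq> g" using x r by auto
      ultimately show "\<exists>d. ((\<lambda>x. m x y) has_real_derivative d) (at x) \<and> d \<le> 0"
        using m_deriv[of x y] by (intro exI[of _ "m' x y"]) simp
    qed (use uv in simp)
    moreover have "F x y / G x y = m x y / ((p - 1) * (k * y))" for x
      by (simp add: F_def G_def m_def mult.commute mult.left_commute)
    ultimately show ?thesis using p_gt_1 k_pos y by (simp add: divide_right_mono)
  qed
  with r(1) show thesis by (rule that)
qed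

text \<open>Uniqueness of the branch of the unstable manifold in \<open>Y > 0\<close>. The condition
  \<open>0 < \<sigma> * (g - \<nu>)\<close> makes \<open>Y\<close> grow near the saddle, so both
  orbits are graphs there; the graphs meet, and a common point determines the orbit.\<close>

lemma saddle_orbit_unique:
  assumes fl: "flow \<sigma> UNIV x1 Y1" "flow \<sigma> UNIV x2 Y2"
    and pos: "\<And>t. 0 < x1 t \<and> 0 < Y1 t" "\<And>t. 0 < x2 t \<and> 0 < Y2 t"
    and lim: "(x1 \<longlongrightarrow> \<nu>) at_bot" "(Y1 \<longlongrightarrow> 0) at_bot" "(x2 \<longlongrightarrow> \<nu>) at_bot" "(Y2 \<longlongrightarrow> 0) at_bot"
    and \<nu>: "\<nu> = \<nu>m \<and> \<nu> < g \<or> \<nu> = \<nu>p \<and> g < \<nu>" and \<sigma>: "0 < \<sigma> * (g - \<nu>)"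
  shows "range (\<lambda>t. (x1 t, Y1 t)) = range (\<lambda>t. (x2 t, Y2 t))"
proof -
  have incr: "\<exists>T. \<forall>t\<le>T. 0 < \<sigma> * G (x t) (Y t)" if "(x \<longlongrightarrow> \<nu>) at_bot" "\<And>t. 0 < Y t" for x Y :: "real \<Rightarrow> real"
  proof -
    have "((\<lambda>t. \<sigma> * (g - x t)) \<longlongrightarrow> \<sigma> * (g - \<nu>)) at_bot" using that by (intro tendsto_intros)
    then have "eventually (\<lambda>t. 0 < \<sigma> * (g - x t)) at_bot" using \<sigma> by (rule order_tendstoD)
    then obtain T where "\<forall>t\<le>T. 0 < \<sigma> * (g - x t)"
      unfolding eventually_at_bot_linorder by blast
    then have "\<forall>t\<le>T. 0 < k * Y t * (\<sigma> * (g - x t))" using that(2) k_pos by simp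
    moreover have "k * Y t * (\<sigma> * (g - x t)) = \<sigma> * G (x t) (Y t)" for t by (simp add: G_def)
    ultimately show ?thesis by auto
  qed
  obtain T1 where T1: "\<And>t. t \<le> T1 \<Longrightarrow> 0 < \<sigma> * G (x1 t) (Y1 t)" using incr lim pos by meson
  obtain T2 where T2: "\<And>t. t \<le> T2 \<Longrightarrow> 0 < \<sigma> * G (x2 t) (Y2 t)" using incr lim pos by meson
  obtain X1 where X1: "\<And>y. 0 < y \<Longrightarrow> y < Y1 T1 \<Longrightarrow> \<exists>t<T1. Y1 t = y \<and> x1 t = X1 y"
    "\<And>y. 0 < y \<Longrightarrow> y < Y1 T1 \<Longrightarrow> (X1 has_real_derivative F (X1 y) y / G (X1 y) y) (at y)"
    "(X1 \<longlongrightarrow> \<nu>) (at_right 0)"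
    using orbit_graph[OF fl(1) _ T1 lim(1,2)] pos by metis
  obtain X2 where X2: "\<And>y. 0 < y \<Longrightarrow> y < Y2 T2 \<Longrightarrow> \<exists>t<T2. Y2 t = y \<and> x2 t = X2 y"
    "\<And>y. 0 < y \<Longrightarrow> y < Y2 T2 \<Longrightarrow> (X2 has_real_derivative F (X2 y) y / G (X2 y) y) (at y)"
    "(X2 \<longlongrightarrow> \<nu>) (at_right 0)"
    using orbit_graph[OF fl(2) _ T2 lim(3,4)] pos by metis
  obtain r where r: "0 < r" "\<And>u v y. \<bar>u - \<nu>\<bar> < r \<Longrightarrow> \<bar>v - \<nu>\<bar> < r \<Longrightarrow> u < v \<Longrightarrow> 0 < y \<Longrightarrow> y < r \<Longrightarrow>
    F v y / G v y \<le> F u y / G u y" using slope_antimono[OF \<nu>] by metis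
  obtain y where y: "0 < y" "y < min (Y1 T1) (Y2 T2)" "X1 y = X2 y"
    by (rule graphs_meet[of "min (Y1 T1) (Y2 T2)" X1 "\<lambda>x y. F x y / G x y" X2 \<nu> r])
      (use X1 X2 pos r in auto)
  then obtain t1 t2 where "Y1 t1 = y" "x1 t1 = X1 y" "Y2 t2 = y" "x2 t2 = X2 y"
    using X1(1)[of y] X2(1)[of y] by auto
  then show ?thesis using flow_unique[OF fl, of t1 t2] pos y(3) by simp
qed


section \<open>Periodic orbits and separatrix cycles\<close>

text \<open>Passing to an open set of times turns derivatives within \<open>T\<close>, possibly
  one-sided at an end point, into full derivatives.\<close>

lemma flow_of_solution:
  assumes "solution_on (field N p s \<mu> q) T \<gamma>" "open U" "U \<subseteq> T"
  shows "flow 1 U (\<lambda>t. fst (\<gamma> t)) (\<lambda>t. snd (\<gamma> t))"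
  unfolding flow_def
proof
  fix t assume t: "t \<in> U"
  have "(\<gamma> has_vector_derivative field N p s \<mu> q (\<gamma> t)) (at t within T)"
    using assms t by (auto simp: solution_on_def)
  then have "(\<gamma> has_vector_derivative field N p s \<mu> q (\<gamma> t)) (at t within U)"
    using assms(3) by (rule has_vector_derivative_within_subset)
  then have "(\<gamma> has_vector_derivative (F (fst (\<gamma> t)) (snd (\<gamma> t)), G (fst (\<gamma> t)) (snd (\<gamma> t)))) (at t)"
    unfolding at_within_open[OF t assms(2)] using field_eq[of "fst (\<gamma> t)" "snd (\<gamma> t)"]
    by (metis prod.collapse)
  note d = this
  show "((\<lambda>t. fst (\<gamma> t)) has_real_derivative 1 * F (fst (\<gamma> t)) (snd (\<gamma> t))) (at t) \<and>
    ((\<lambda>t. snd (\<gamma> t)) has_real_derivative 1 * G (fst (\<gamma> t)) (snd (\<gamma> t))) (at t)"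
    using bounded_linear.has_vector_derivative[OF bounded_linear_fst d]
      bounded_linear.has_vector_derivative[OF bounded_linear_snd d]
    by (simp add: has_real_derivative_iff_has_vector_derivative)
qed

lemma flow_reverse:
  assumes "flow 1 UNIV x Y" "\<sigma> = 1 \<or> \<sigma> = - 1"
  shows "flow \<sigma> UNIV (\<lambda>t. x (\<sigma> * t)) (\<lambda>t. Y (\<sigma> * t))"
  unfolding flow_def
proof (intro ballI conjI)
  fix t
  have d: "((\<lambda>t. \<sigma> * t) has_real_derivative \<sigma>) (at t)"
    by (rule derivative_eq_intros refl)+ simp
  show "((\<lambda>t. x (\<sigma> * t)) has_real_derivative \<sigma> * F (x (\<sigma> * t)) (Y (\<sigma> * t))) (at t)"
    using DERIV_chain2[OF _ d, of x "F (x (\<sigma> * t)) (Y (\<sigma> * t))"] assms(1)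
    by (simp add: flow_def mult.commute)
  show "((\<lambda>t. Y (\<sigma> * t)) has_real_derivative \<sigma> * G (x (\<sigma> * t)) (Y (\<sigma> * t))) (at t)"
    using DERIV_chain2[OF _ d, of Y "G (x (\<sigma> * t)) (Y (\<sigma> * t))"] assms(1)
    by (simp add: flow_def mult.commute)
qed

lemma equilibrium_orbit:
  assumes fl: "flow \<sigma> UNIV x Y" and pos: "\<And>t. 0 < x t"
    and eq: "F (x a) (Y a) = 0" "G (x a) (Y a) = 0"
  shows "x t = x a \<and> Y t = Y a"
proof -
  have "flow \<sigma> UNIV (\<lambda>_. x a) (\<lambda>_. Y a)" using eq by (simp add: flow_def)
  then have "range (\<lambda>t. (x t, Y t)) = range (\<lambda>t :: real. (x a, Y a))"
    using flow_unique[OF fl, of "\<lambda>_. x a" "\<lambda>_. Y a" a] pos by auto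
  then show ?thesis by (metis (mono_tags, lifting) Pair_inject UNIV_I image_iff)
qed

lemma F_interior: "F g (h N p g - \<mu>) = 0" "G g (h N p g - \<mu>) = 0"
  by (simp_all add: F_def G_def)

lemma no_periodic_orbit:
  assumes "c \<noteq> 0" and S: "S \<subseteq> {0<..} \<times> {0..}" and "periodic_orbit (field N p s \<mu> q) S"
  shows False
proof -
  obtain \<gamma> T where \<gamma>: "solution_on (field N p s \<mu> q) UNIV \<gamma>" "S = range \<gamma>"
      "\<not> \<gamma> constant_on UNIV" "0 < T" "\<And>t. \<gamma> (t + T) = \<gamma> t"
    using assms(3) unfolding periodic_orbit_def by blast
  define x Y where "x t = fst (\<gamma> t)" and "Y t = snd (\<gamma> t)" for t
  have fl: "flow 1 UNIV x Y"
    using flow_of_solution[OF \<gamma>(1), of UNIV] by (simp add: x_def[abs_def] Y_def[abs_def])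
  have "\<gamma> t \<in> {0<..} \<times> {0..}" for t using S \<gamma>(2) by auto
  then have pos: "0 < x t" "0 \<le> Y t" for t by (auto simp: x_def Y_def mem_Times_iff)
  \<comment> \<open>An orbit through an equilibrium is constant, so finding one on the orbit gives
    the contradiction. On the axis \<open>V\<close> is useless, but the periodic function
    \<open>x\<close> has a maximum, where its derivative \<open>F\<close> vanishes.\<close>
  have "\<exists>a. F (x a) (Y a) = 0 \<and> G (x a) (Y a) = 0"
  proof (cases "\<exists>a. Y a = 0")
    case True
    then have Y0: "Y t = 0" for t using flow_stays_on_axis[OF fl is_interval_univ, of _ t] by blast
    have "continuous_on {0..T} x" using flow_continuous[OF fl, of "{0..T}"] by simp
    then obtain a where a: "a \<in> {0..T}" "\<And>t. t \<in> {0..T} \<Longrightarrow> x t \<le> x a"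
      using continuous_attains_sup[of "{0..T}" x] \<gamma>(4) by auto
    have per: "\<gamma> (t + of_int n * T) = \<gamma> t" for t n
    proof (induction n rule: int_induct[where k = 0])
      case (step1 i)
      then show ?case using \<gamma>(5)[of "t + of_int i * T"] by (simp add: algebra_simps)
    next
      case (step2 i)
      then show ?case using \<gamma>(5)[of "t + of_int (i - 1) * T"] by (simp add: algebra_simps)
    qed simp
    have max: "x t \<le> x a" for t
    proof -
      define n where "n = \<lfloor>t / T\<rfloor>"
      have "of_int n \<le> t / T" "t / T < of_int n + 1" by (auto simp: n_def)
      then have "t - of_int n * T \<in> {0..T}" using \<gamma>(4) by (auto simp: field_simps)
      moreover have "x t = x (t - of_int n * T)" using per[of "t - of_int n * T" n] by (simp add: x_def)
      ultimately show ?thesis using a(2) by simp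
    qed
    have "(x has_real_derivative 1 * F (x a) (Y a)) (at a)" using fl by (auto simp: flow_def)
    then have "1 * F (x a) (Y a) = 0"
      by (rule DERIV_local_max[of _ _ _ 1]) (use max in auto)
    then show ?thesis using Y0 by (intro exI[of _ a]) (simp add: G_def)
  next
    case False
    then have pos': "0 < x t \<and> 0 < Y t" for t using pos[of t] by (metis less_eq_real_def)
    have "x 0 = g \<and> Y 0 = h N p g - \<mu>"
    proof (rule V_repeat_imp_equilibrium[OF fl _ pos'])
      show "V (x 0) (Y 0) = V (x T) (Y T)" using \<gamma>(5)[of 0] by (simp add: x_def Y_def)
    qed (use \<gamma>(4) \<open>c \<noteq> 0\<close> in auto)
    then show ?thesis using F_interior by (intro exI[of _ 0]) simp
  qed
  then obtain a where "F (x a) (Y a) = 0" "G (x a) (Y a) = 0" by auto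
  then have "\<gamma> t = \<gamma> a" for t
    using equilibrium_orbit[OF fl pos(1), of a t] by (auto simp only: x_def Y_def intro: prod_eqI)
  then show False using \<gamma>(3) by (metis constant_on_def)
qed

section \<open>Orbits joining a saddle on the axis to the interior equilibrium\<close>

text \<open>Time is oriented by \<open>\<sigma>\<close> so that the orbit always starts at the
  saddle. The last two conditions let \<open>\<sigma>\<close> determine which root
  \<open>\<nu>\<close> is.\<close>

definition "connecting \<sigma> \<nu> x Y \<longleftrightarrow> flow \<sigma> UNIV x Y \<and> (\<forall>t. 0 < x t \<and> 0 < Y t) \<and>
  (x \<longlongrightarrow> \<nu>) at_bot \<and> (Y \<longlongrightarrow> 0) at_bot \<and> (x \<longlongrightarrow> g) at_top \<and> (Y \<longlongrightarrow> h N p g - \<mu>) at_top \<and>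
  \<mu> < h N p g \<and> (\<nu> = \<nu>m \<and> \<nu> < g \<or> \<nu> = \<nu>p \<and> g < \<nu>) \<and> 0 < \<sigma> * (g - \<nu>)"

lemma V_nonincreasing:
  assumes fl: "flow \<sigma> T x Y" and T: "{a..b} \<subseteq> T" and pos: "\<And>t. t \<in> T \<Longrightarrow> 0 < x t \<and> 0 < Y t"
    and "a \<le> b" "0 \<le> \<sigma> * c"
  shows "V (x b) (Y b) \<le> V (x a) (Y a)"
proof (rule DERIV_nonpos_imp_nonincreasing[where f = "\<lambda>t. V (x t) (Y t)", OF \<open>a \<le> b\<close>])
  fix t assume "a \<le> t" "t \<le> b"
  then have t: "t \<in> T" using T by auto
  have "- \<sigma> * c * W (x t) (Y t) \<le> 0"
    using W_nonneg[of "x t" "Y t"] pos[OF t] mult_nonneg_nonneg[OF assms(5), of "W (x t) (Y t)"] by simp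
  then show "\<exists>d. ((\<lambda>t. V (x t) (Y t)) has_real_derivative d) (at t) \<and> d \<le> 0"
    using V_flow[OF fl t] pos[OF t] by blast
qed

lemma equilibrium_value:
  assumes "0 < x" "0 \<le> Y" "F x Y = 0" "G x Y = 0"
  shows "Y = 0 \<and> (x = \<nu>m \<or> x = \<nu>p) \<and> V x Y = 0 \<or>
    x = g \<and> Y = h N p g - \<mu> \<and> \<mu> < h N p g \<and> V x Y < 0"
proof (cases "Y = 0")
  case True
  then show ?thesis using equilibrium_iff[OF assms(1), of Y] assms h_eq_iff[OF assms(1)] V_axis by auto
next
  case False
  then have "x = g" "Y = h N p g - \<mu>" "\<mu> < h N p g" using equilibrium_iff[OF assms(1), of Y] assms by auto
  then show ?thesis using V_interior_equilibrium by auto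
qed

text \<open>\<open>V\<close> drops strictly along the orbit, while equilibria offer only the value
  \<open>0\<close> on the axis and one negative value in the interior. The orbit therefore starts on
  the axis and ends at the interior equilibrium.\<close>

lemma connecting_orbitI:
  assumes fl: "flow \<sigma> UNIV x Y" and pos: "\<And>t. 0 < x t \<and> 0 < Y t" and \<sigma>: "0 < \<sigma> * c"
    and lim: "(x \<longlongrightarrow> x1) at_bot" "(Y \<longlongrightarrow> Y1) at_bot" "(x \<longlongrightarrow> x2) at_top" "(Y \<longlongrightarrow> Y2) at_top"
    and e1: "0 < x1" "0 \<le> Y1" "F x1 Y1 = 0" "G x1 Y1 = 0"
    and e2: "0 < x2" "0 \<le> Y2" "F x2 Y2 = 0" "G x2 Y2 = 0"
    and ne: "\<not> (x 0 = g \<and> Y 0 = h N p g - \<mu>)"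
  shows "connecting \<sigma> x1 x Y \<and> Y1 = 0 \<and> x2 = g \<and> Y2 = h N p g - \<mu>"
proof -
  have mono: "V (x t) (Y t) \<le> V (x u) (Y u)" if "u \<le> t" for u t
    using V_nonincreasing[OF fl _ _ that] pos \<sigma> by auto
  have Y_ev: "eventually (\<lambda>t. 0 \<le> Y t) A" for A using pos by (simp add: less_imp_le)
  have "V (x t) (Y t) \<le> V x1 Y1" for t
    using V_tendsto[OF lim(1,2) e1(1) Y_ev]
    by (rule tendsto_lowerbound) (use mono in \<open>auto simp: eventually_at_bot_linorder\<close>)
  moreover have "V x2 Y2 \<le> V (x t) (Y t)" for t
    using V_tendsto[OF lim(3,4) e2(1) Y_ev]
    by (rule tendsto_upperbound) (use mono in \<open>auto simp: eventually_at_top_linorder\<close>)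
  ultimately have V12: "V x2 Y2 \<le> V (x t) (Y t)" "V (x t) (Y t) \<le> V x1 Y1" for t by auto
  have "V x2 Y2 \<noteq> V x1 Y1"
  proof
    assume "V x2 Y2 = V x1 Y1"
    then have "V (x 0) (Y 0) = V (x 1) (Y 1)" using V12 by (metis order_antisym)
    then have "x 0 = g \<and> Y 0 = h N p g - \<mu>"
      by (rule V_repeat_imp_equilibrium[OF fl subset_UNIV pos zero_less_one]) (use \<sigma> in auto)
    then show False using ne by simp
  qed
  then have V_less: "V x2 Y2 < V x1 Y1" using V12[of 0] by linarith
  have P: "Y1 = 0" "x1 = \<nu>m \<or> x1 = \<nu>p" "x2 = g" "Y2 = h N p g - \<mu>" "\<mu> < h N p g"
    using equilibrium_value[OF e1] equilibrium_value[OF e2] V_less by auto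
  have g: "\<nu>m < g" "g < \<nu>p" using between_roots[OF g_pos P(5)] by auto
  have "0 < \<sigma> * (g - x1)"
  proof (rule ccontr)
    assume "\<not> 0 < \<sigma> * (g - x1)"
    moreover have "\<sigma> * (g - x1) \<noteq> 0" using \<sigma> g P(2) by auto
    ultimately have "\<sigma> * (g - x1) < 0" by linarith
    moreover have "((\<lambda>t. \<sigma> * (g - x t)) \<longlongrightarrow> \<sigma> * (g - x1)) at_bot" using lim by (intro tendsto_intros)
    ultimately have "eventually (\<lambda>t. \<sigma> * (g - x t) < 0) at_bot" by (intro order_tendstoD)
    then obtain T where T: "\<And>t. t \<le> T \<Longrightarrow> \<sigma> * (g - x t) < 0" unfolding eventually_at_bot_linorder by blast
    \<comment> \<open>With the wrong sign \<open>Y\<close> would not increase up to time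
      \<open>T\<close>, so its limit \<open>0\<close> in the past would be at least
      \<open>Y T > 0\<close>.\<close>
    have "Y T \<le> Y t" if "t \<le> T" for t
    proof (rule DERIV_nonpos_imp_nonincreasing[OF that])
      fix u assume "t \<le> u" "u \<le> T"
      then have "k * Y u * (\<sigma> * (g - x u)) \<le> 0"
        using T[of u] pos[of u] k_pos mult_nonneg_nonpos[of "k * Y u" "\<sigma> * (g - x u)"] by simp
      then show "\<exists>d. (Y has_real_derivative d) (at u) \<and> d \<le> 0"
        using fl by (intro exI[of _ "\<sigma> * G (x u) (Y u)"]) (simp add: flow_def G_def mult_ac)
    qed
    then have "Y T \<le> Y1"
      by (intro tendsto_lowerbound[OF lim(2)]) (auto simp: eventually_at_bot_linorder)
    then show False using pos[of T] P(1) by simp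
  qed
  then show ?thesis
    using fl pos lim P g by (auto simp: connecting_def)
qed

text \<open>\<open>V\<close> is injective on the closure of a connecting orbit, hence a homeomorphism onto an interval.\<close>

lemma connecting_arc:
  assumes con: "connecting \<sigma> \<nu> x Y" and \<sigma>: "0 < \<sigma> * c"
  defines "A \<equiv> insert (\<nu>, 0) (insert (g, h N p g - \<mu>) (range (\<lambda>t. (x t, Y t))))"
  shows "compact A" "AR A" "A \<inter> UNIV \<times> {0} = {(\<nu>, 0)}"
proof -
  have fl: "flow \<sigma> UNIV x Y" and pos: "\<And>t. 0 < x t \<and> 0 < Y t" and hg: "\<mu> < h N p g"
    and lim: "(x \<longlongrightarrow> \<nu>) at_bot" "(Y \<longlongrightarrow> 0) at_bot" "(x \<longlongrightarrow> g) at_top" "(Y \<longlongrightarrow> h N p g - \<mu>) at_top"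
    and "0 < \<nu>"
    using con roots by (auto simp: connecting_def)
  let ?\<gamma> = "\<lambda>t. (x t, Y t)" and ?V = "\<lambda>z. V (fst z) (snd z)"
  have bot: "(?\<gamma> \<longlongrightarrow> (\<nu>, 0)) at_bot" and top: "(?\<gamma> \<longlongrightarrow> (g, h N p g - \<mu>)) at_top"
    using lim by (auto intro: tendsto_Pair)
  have cont: "continuous_on UNIV ?\<gamma>"
    using flow_continuous[OF fl, of UNIV] by (auto intro: continuous_on_Pair)
  show "compact A" unfolding A_def by (rule compact_range_with_limits[OF cont bot top])
  show "A \<inter> UNIV \<times> {0} = {(\<nu>, 0)}" using pos hg by (auto simp: A_def) (metis less_irrefl)+
  \<comment> \<open>Points of the closure may be added to the connected orbit without losing
    connectedness, so the image of \<open>A\<close> under \<open>V\<close> will be an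
    interval.\<close>
  have "(\<nu>, 0) \<in> closure (range ?\<gamma>)"
    by (rule Lim_in_closed_set[OF closed_closure _ _ bot]) (auto simp: closure_subset[THEN subsetD])
  moreover have "(g, h N p g - \<mu>) \<in> closure (range ?\<gamma>)"
    by (rule Lim_in_closed_set[OF closed_closure _ _ top]) (auto simp: closure_subset[THEN subsetD])
  ultimately have "A \<subseteq> closure (range ?\<gamma>)" using closure_subset[of "range ?\<gamma>"] by (simp add: A_def)
  then have "connected A"
    using connected_continuous_image[OF cont connected_UNIV]
    by (rule_tac connected_intermediate_closure[of "range ?\<gamma>"]) (auto simp: A_def)
  have contV: "continuous_on A ?V"
    by (rule continuous_on_subset[OF V_continuous_on])
      (use pos hg g_pos \<open>0 < \<nu>\<close> in \<open>auto simp: A_def less_imp_le\<close>)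
  have mono: "V (x t) (Y t) \<le> V (x u) (Y u)" if "u \<le> t" for u t
    using V_nonincreasing[OF fl _ _ that] pos \<sigma> by auto
  have rep: "?\<gamma> u = (g, h N p g - \<mu>) \<and> ?\<gamma> t = (g, h N p g - \<mu>)"
    if "u < t" "V (x u) (Y u) = V (x t) (Y t)" for u t
  proof -
    have "\<sigma> * c \<noteq> 0" using \<sigma> by linarith
    note V_repeat_imp_equilibrium[OF fl subset_UNIV pos that this]
    from this[of u] this[of t] show ?thesis using that(1) by simp
  qed
  have Y_ev: "eventually (\<lambda>t. 0 \<le> Y t) B" for B using pos by (simp add: less_imp_le)
  have le0: "V (x t) (Y t) \<le> V \<nu> 0" for t
    using V_tendsto[OF lim(1,2) \<open>0 < \<nu>\<close> Y_ev]
    by (rule tendsto_lowerbound) (use mono in \<open>auto simp: eventually_at_bot_linorder\<close>)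
  have ge: "V g (h N p g - \<mu>) \<le> V (x t) (Y t)" for t
    using V_tendsto[OF lim(3,4) g_pos Y_ev]
    by (rule tendsto_upperbound) (use mono in \<open>auto simp: eventually_at_top_linorder\<close>)
  note neg = V_interior_equilibrium[OF hg]
  \<comment> \<open>If an extreme value were attained at \<open>t\<close>, monotonicity would force
    it also one time unit earlier (for \<open>0\<close>) or later (for the minimum). A repeated
    value occurs only at the interior equilibrium, where \<open>V < 0\<close>.\<close>
  have V0: "V (x t) (Y t) < 0" for t
  proof (rule ccontr)
    assume "\<not> V (x t) (Y t) < 0"
    then have "V (x t) (Y t) = 0" "V (x (t - 1)) (Y (t - 1)) = 0"
      using le0[of t] le0[of "t - 1"] mono[of "t - 1" t] V_axis by auto
    then show False using rep[of "t - 1" t] neg by auto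
  qed
  have V1: "?\<gamma> t = (g, h N p g - \<mu>)" if "V (x t) (Y t) = V g (h N p g - \<mu>)" for t
  proof -
    have "V (x (t + 1)) (Y (t + 1)) = V (x t) (Y t)"
      using that ge[of "t + 1"] mono[of t "t + 1"] by simp
    then show ?thesis using rep[of t "t + 1"] by simp
  qed
  have Veq: "?\<gamma> u = ?\<gamma> t" if "V (x u) (Y u) = V (x t) (Y t)" for u t
    using rep[of u t] rep[of t u] that by (cases u t rule: linorder_cases) auto
  have "inj_on ?V A"
    unfolding A_def inj_on_insert
  proof (intro conjI)
    show "inj_on ?V (range ?\<gamma>)" using Veq by (auto simp: inj_on_def)
    show "?V (g, h N p g - \<mu>) \<notin> ?V ` (range ?\<gamma> - {(g, h N p g - \<mu>)})"
      using V1 by force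
    show "?V (\<nu>, 0) \<notin> ?V ` (insert (g, h N p g - \<mu>) (range ?\<gamma>) - {(\<nu>, 0)})"
    proof
      assume "?V (\<nu>, 0) \<in> ?V ` (insert (g, h N p g - \<mu>) (range ?\<gamma>) - {(\<nu>, 0)})"
      then obtain z where z: "z \<in> insert (g, h N p g - \<mu>) (range ?\<gamma>)" "?V (\<nu>, 0) = ?V z"
        by blast
      then have "?V z = 0" using V_axis by simp
      moreover have "?V z < 0" using z(1) neg V0 by (elim insertE imageE) (simp_all only: fst_conv snd_conv)
      ultimately show False by simp
    qed
  qed
  then have "A homeomorphic (?V ` A)"
    using homeomorphic_compact[OF \<open>compact A\<close> contV] by blast
  moreover have "convex (?V ` A)"
    using connected_continuous_image[OF contV \<open>connected A\<close>] by (metis is_interval_convex_1 is_interval_connected_1)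
  moreover have "?V ` A \<noteq> {}" by (simp add: A_def)
  ultimately show "AR A"
    using homeomorphic_AR_iff_AR convex_imp_AR by blast
qed

lemma no_separatrix_cycle:
  assumes "c \<noteq> 0" and S: "S \<subseteq> {0<..} \<times> {0..}" and cyc: "separatrix_cycle (field N p s \<mu> q) S"
  shows False
proof -
  obtain E \<Gamma> D where "compact S" and E: "\<And>e. e \<in> E \<Longrightarrow> equilibrium (field N p s \<mu> q) e"
    and \<Gamma>: "\<And>\<gamma>. \<gamma> \<in> \<Gamma> \<Longrightarrow> solution_on (field N p s \<mu> q) UNIV \<gamma>"
      "\<And>\<gamma>. \<gamma> \<in> \<Gamma> \<Longrightarrow> \<exists>e\<in>E. (\<gamma> \<longlongrightarrow> e) at_bot" "\<And>\<gamma>. \<gamma> \<in> \<Gamma> \<Longrightarrow> \<exists>e\<in>E. (\<gamma> \<longlongrightarrow> e) at_top"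
    and S_eq: "S = E \<union> (\<Union>\<gamma>\<in>\<Gamma>. range \<gamma>)" and D: "D \<in> components (- S)" "bounded D"
    using cyc unfolding separatrix_cycle_def by metis
  \<comment> \<open>Time is reversed when \<open>c < 0\<close>, so that \<open>V\<close> never
    increases along the oriented orbits.\<close>
  define \<sigma> where "\<sigma> = sgn c"
  have \<sigma>: "\<sigma> = 1 \<or> \<sigma> = - 1" "0 < \<sigma> * c" using \<open>c \<noteq> 0\<close> by (auto simp: \<sigma>_def sgn_if)
  let ?P = "(g, h N p g - \<mu>)"
  have E': "0 < fst e \<and> 0 \<le> snd e \<and> F (fst e) (snd e) = 0 \<and> G (fst e) (snd e) = 0" if "e \<in> E" for e
    using E[OF that] S S_eq that field_eq[of "fst e" "snd e"]
    by (auto simp: equilibrium_def zero_prod_def)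
  have E_cases: "snd e = 0 \<or> e = ?P" if "e \<in> E" for e
    using equilibrium_value E'[OF that] by (auto simp: prod_eq_iff)
  \<comment> \<open>\<open>\<Gamma>\<close> may be infinite and contain constant orbits. Every
    member is one of three kinds, and the third contributes only a single point set by
    uniqueness.\<close>
  have orbit: "range \<gamma> \<subseteq> UNIV \<times> {0} \<or> range \<gamma> = {?P} \<or>
      (\<exists>\<nu> x Y. connecting \<sigma> \<nu> x Y \<and> range \<gamma> = range (\<lambda>t. (x t, Y t)) \<and> (\<nu>, 0) \<in> E \<and> ?P \<in> E)"
    if \<gamma>: "\<gamma> \<in> \<Gamma>" for \<gamma>
  proof -
    define x Y where "x t = fst (\<gamma> (\<sigma> * t))" and "Y t = snd (\<gamma> (\<sigma> * t))" for t
    have fl: "flow \<sigma> UNIV x Y"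
      using flow_reverse[OF flow_of_solution[OF \<Gamma>(1)[OF \<gamma>], of UNIV] \<sigma>(1)]
      by (simp add: x_def[abs_def] Y_def[abs_def])
    have "\<gamma> t \<in> {0<..} \<times> {0..}" for t using S S_eq \<gamma> by blast
    then have pos: "0 < x t" "0 \<le> Y t" for t by (auto simp: x_def Y_def mem_Times_iff)
    have \<gamma>_eq: "\<gamma> t = (x (\<sigma> * t), Y (\<sigma> * t))" for t using \<sigma>(1) by (auto simp: x_def Y_def)
    have range_eq: "range \<gamma> = range (\<lambda>t. (x t, Y t))"
    proof (intro equalityI image_subsetI)
      show "\<gamma> t \<in> range (\<lambda>t. (x t, Y t))" for t using \<gamma>_eq[of t] by (intro range_eqI)
      show "(x t, Y t) \<in> range \<gamma>" for t by (simp add: x_def Y_def)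
    qed
    obtain e1 e2 where e: "e1 \<in> E" "e2 \<in> E" "((\<lambda>t. \<gamma> (\<sigma> * t)) \<longlongrightarrow> e1) at_bot" "((\<lambda>t. \<gamma> (\<sigma> * t)) \<longlongrightarrow> e2) at_top"
    proof (cases "\<sigma> = 1")
      case True
      then show ?thesis using that \<Gamma>(2,3)[OF \<gamma>] by auto
    next
      case False
      then have "\<sigma> = - 1" using \<sigma>(1) by simp
      moreover obtain e1 e2 where "e1 \<in> E" "(\<gamma> \<longlongrightarrow> e1) at_bot" "e2 \<in> E" "(\<gamma> \<longlongrightarrow> e2) at_top"
        using \<Gamma>(2,3)[OF \<gamma>] by auto
      ultimately show ?thesis
        using that[of e2 e1] filterlim_at_top_mirror[of \<gamma> "nhds e2"] filterlim_at_bot_mirror[of \<gamma> "nhds e1"] by simp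
    qed
    have lim: "(x \<longlongrightarrow> fst e1) at_bot" "(Y \<longlongrightarrow> snd e1) at_bot" "(x \<longlongrightarrow> fst e2) at_top" "(Y \<longlongrightarrow> snd e2) at_top"
      using e(3,4) by (auto simp: x_def[abs_def] Y_def[abs_def] intro: tendsto_fst tendsto_snd)
    show ?thesis
    proof (cases "\<exists>a. Y a = 0")
      case True
      then have "Y t = 0" for t using flow_stays_on_axis[OF fl is_interval_univ, of _ t] by blast
      then show ?thesis by (auto simp: range_eq)
    next
      case False
      then have pos': "0 < x t \<and> 0 < Y t" for t using pos[of t] by (metis less_eq_real_def)
      show ?thesis
      proof (cases "x 0 = g \<and> Y 0 = h N p g - \<mu>")
        case True
        then have "F (x 0) (Y 0) = 0" "G (x 0) (Y 0) = 0" using F_interior by simp_all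
        then have "x t = g \<and> Y t = h N p g - \<mu>" for t
          using equilibrium_orbit[OF fl pos(1), of 0 t] True by simp
        then show ?thesis by (auto simp: range_eq)
      next
        case False
        then have "connecting \<sigma> (fst e1) x Y \<and> snd e1 = 0 \<and> fst e2 = g \<and> snd e2 = h N p g - \<mu>"
          using connecting_orbitI[OF fl pos' \<sigma>(2) lim] E'[OF e(1)] E'[OF e(2)] by blast
        then have "connecting \<sigma> (fst e1) x Y" "e1 = (fst e1, 0)" "e2 = ?P"
          by (auto simp: prod_eq_iff)
        then show ?thesis using e(1,2) range_eq by metis
      qed
    qed
  qed
  obtain B where B: "\<And>z. z \<in> S \<Longrightarrow> norm z \<le> B"
    using compact_imp_bounded[OF \<open>compact S\<close>] by (auto simp: bounded_iff)
  \<comment> \<open>\<open>L\<close> may be larger than the part of the cycle on the axis: extra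
    axis points do no harm in \<open>no_bounded_component\<close>, and a segment is convex.\<close>
  define L where "L = {- B..B} \<times> {0 :: real}"
  have L: "compact L" "convex L" by (auto simp: L_def intro: compact_Times convex_Times)
  have axis: "z \<in> L" if "z \<in> S" "snd z = 0" for z
    using B[OF that(1)] norm_fst_le[of "fst z" "snd z"] that(2) by (cases z) (auto simp: L_def)
  have axis_subset: "R \<subseteq> L" if "R \<subseteq> S" "R \<subseteq> UNIV \<times> {0}" for R
  proof
    fix z assume "z \<in> R"
    then have "z \<in> S" "z \<in> UNIV \<times> {0}" using that by auto
    then show "z \<in> L" by (intro axis) (auto simp: mem_Times_iff)
  qed
  have main: False if T: "S \<subseteq> T" "T \<subseteq> S \<union> UNIV \<times> {0}" "bounded T" "connected (- T)" for T
    using no_bounded_component[OF _ compact_imp_closed[OF \<open>compact S\<close>] T D(1)] D(2) S by auto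
  show False
  proof (cases "\<exists>\<nu> x Y. connecting \<sigma> \<nu> x Y \<and> range (\<lambda>t. (x t, Y t)) \<subseteq> S \<and> (\<nu>, 0) \<in> S \<and> ?P \<in> S")
    case True
    then obtain \<nu> x Y where con: "connecting \<sigma> \<nu> x Y" "range (\<lambda>t. (x t, Y t)) \<subseteq> S" "(\<nu>, 0) \<in> S" "?P \<in> S"
      by auto
    define A where "A = insert (\<nu>, 0) (insert ?P (range (\<lambda>t. (x t, Y t))))"
    note A = connecting_arc[OF con(1) \<sigma>(2), folded A_def]
    have "range \<gamma> \<subseteq> L \<union> A" if \<gamma>: "\<gamma> \<in> \<Gamma>" for \<gamma>
      using orbit[OF \<gamma>]
    proof (elim disjE exE conjE)
      assume "range \<gamma> \<subseteq> UNIV \<times> {0}"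
      moreover have "range \<gamma> \<subseteq> S" using S_eq \<gamma> by blast
      ultimately have "range \<gamma> \<subseteq> L" by (intro axis_subset)
      then show ?thesis by blast
    next
      assume "range \<gamma> = {?P}" then show ?thesis by (auto simp: A_def)
    next
      fix \<nu>' x' Y' assume con': "connecting \<sigma> \<nu>' x' Y'" and r: "range \<gamma> = range (\<lambda>t. (x' t, Y' t))"
      \<comment> \<open>The sign of \<open>\<sigma>\<close> fixes the sign of
        \<open>g - \<nu>\<close>, and with it the root.\<close>
      have "\<nu>' = \<nu>"
        using con(1) con' unfolding connecting_def by (auto simp: zero_less_mult_iff)
      then have "range (\<lambda>t. (x' t, Y' t)) = range (\<lambda>t. (x t, Y t))"
        using con(1) con' unfolding connecting_def by (intro saddle_orbit_unique[of \<sigma> _ _ _ _ \<nu>]) auto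
      then show ?thesis using r by (auto simp: A_def)
    qed
    moreover have "E \<subseteq> L \<union> A" using E_cases axis S_eq by (auto simp: A_def)
    ultimately have "S \<subseteq> L \<union> A" using S_eq by blast
    moreover have "L \<union> A \<subseteq> S \<union> UNIV \<times> {0}" using con by (auto simp: A_def L_def)
    moreover have "bounded (L \<union> A)" using L A by (simp add: compact_imp_bounded)
    moreover have "connected (- (L \<union> A))"
    proof (rule connected_complement_absolute_retract)
      have "(\<nu>, 0) \<in> L" using axis con(3) by simp
      moreover have "(\<nu>, 0) \<in> A" by (simp add: A_def)
      moreover have "L \<subseteq> UNIV \<times> {0}" unfolding L_def by (intro Sigma_mono) simp_all
      then have "L \<inter> A \<subseteq> {(\<nu>, 0)}" using A(3) by blast
      \<comment> \<open>Two absolute retracts that meet in a point have an absolute retract as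
        union, and a compact one does not separate the plane.\<close>
      ultimately have LA: "L \<inter> A = {(\<nu>, 0)}" by blast
      show "AR (L \<union> A)"
        using L A \<open>(\<nu>, 0) \<in> L\<close> by (intro AR_closed_Un) (auto simp: compact_imp_closed LA intro: convex_imp_AR)
      show "compact (L \<union> A)" using L A by (intro compact_Un)
    qed simp
    ultimately show False by (rule main)
  next
    case False
    \<comment> \<open>Intersecting with \<open>S\<close> is needed because the enlarged set may
      exceed \<open>S\<close> only by points of the axis.\<close>
    have "range \<gamma> \<subseteq> L \<union> {?P} \<inter> S" if \<gamma>: "\<gamma> \<in> \<Gamma>" for \<gamma>
      using orbit[OF \<gamma>]
    proof (elim disjE)
      assume "range \<gamma> \<subseteq> UNIV \<times> {0}"
      moreover have "range \<gamma> \<subseteq> S" using S_eq \<gamma> by blast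
      ultimately have "range \<gamma> \<subseteq> L" by (intro axis_subset)
      then show ?thesis by blast
    next
      assume "range \<gamma> = {?P}" then show ?thesis using S_eq \<gamma> by auto
    next
      assume "\<exists>\<nu> x Y. connecting \<sigma> \<nu> x Y \<and> range \<gamma> = range (\<lambda>t. (x t, Y t)) \<and> (\<nu>, 0) \<in> E \<and> ?P \<in> E"
      then show ?thesis using False S_eq \<gamma> by blast
    qed
    moreover have "E \<subseteq> L \<union> {?P} \<inter> S" using E_cases axis S_eq by auto
    ultimately have "S \<subseteq> L \<union> {?P} \<inter> S" using S_eq by blast
    moreover have "L \<union> {?P} \<inter> S \<subseteq> S \<union> UNIV \<times> {0}" by (auto simp: L_def)
    moreover have "bounded (L \<union> {?P} \<inter> S)"
      using L \<open>compact S\<close> by (simp add: compact_imp_bounded bounded_Int)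
    moreover have "connected (- (L \<union> {?P} \<inter> S))"
    proof -
      have "connected (- L)"
        using connected_complement_homeomorphic_convex_compact[OF homeomorphic_refl L(2,1)] by simp
      moreover have "open (- L)" using L by (simp add: compact_imp_closed open_Compl)
      ultimately have "connected (- L - {?P})" by (intro connected_open_delete) auto
      moreover have "- (L \<union> {?P} \<inter> S) = (if ?P \<in> S then - L - {?P} else - L)" by auto
      ultimately show ?thesis using \<open>connected (- L)\<close> by simp
    qed
    ultimately show False by (rule main)
  qed
qed

end

section \<open>Convergence of bounded solutions\<close>

text \<open>On the compact set where \<open>\<bar>f\<bar>\<close> is at least \<open>e\<close>,
  \<open>w\<close> has no zero, so \<open>\<bar>w\<bar>\<close> is bounded away from
  \<open>0\<close> there; eventually \<open>z t\<close> must avoid that set.\<close>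

lemma tendsto_zero_on_compact:
  fixes f w :: "'a :: metric_space \<Rightarrow> real"
  assumes K: "compact K" "continuous_on K f" "continuous_on K w"
    and zero: "\<And>z. z \<in> K \<Longrightarrow> w z = 0 \<Longrightarrow> f z = 0"
    and z: "eventually (\<lambda>t. z t \<in> K) A" and lim: "((\<lambda>t. w (z t)) \<longlongrightarrow> 0) A"
  shows "((\<lambda>t. f (z t)) \<longlongrightarrow> 0) A"
proof (rule tendstoI)
  fix e :: real assume "0 < e"
  define C where "C = K \<inter> (\<lambda>z. \<bar>f z\<bar>) -` {e..}"
  have "closed C"
    unfolding C_def using K by (intro continuous_closed_preimage continuous_intros compact_imp_closed) auto
  then have "compact C" using K(1) by (metis C_def compact_Int_closed inf.left_idem)
  have contC: "continuous_on C (\<lambda>z. \<bar>w z\<bar>)"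
    using K(3) by (intro continuous_intros) (auto intro: continuous_on_subset simp: C_def)
  have "\<exists>m>0. \<forall>z\<in>C. m \<le> \<bar>w z\<bar>"
  proof (cases "C = {}")
    case True then show ?thesis by (auto intro: exI[of _ 1])
  next
    case False
    then obtain z0 where z0: "z0 \<in> C" "\<And>z. z \<in> C \<Longrightarrow> \<bar>w z0\<bar> \<le> \<bar>w z\<bar>"
      using continuous_attains_inf[OF \<open>compact C\<close> False contC] by auto
    have "w z0 \<noteq> 0" using zero[of z0] z0(1) \<open>0 < e\<close> by (auto simp: C_def)
    then show ?thesis using z0(2) by (intro exI[of _ "\<bar>w z0\<bar>"]) auto
  qed
  then obtain m where m: "0 < m" "\<And>z. z \<in> C \<Longrightarrow> m \<le> \<bar>w z\<bar>" by auto
  have "eventually (\<lambda>t. dist (w (z t)) 0 < m) A" using lim m(1) by (rule tendstoD)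
  with z show "eventually (\<lambda>t. dist (f (z t)) 0 < e) A"
  proof eventually_elim
    case (elim t)
    then have "\<not> e \<le> \<bar>f (z t)\<bar>" using m(2)[of "z t"] by (auto simp: C_def)
    then show ?case by simp
  qed
qed

lemma one_sided_if_avoids:
  fixes u :: "real \<Rightarrow> real"
  assumes cont: "continuous_on {T..} u" and ne: "\<And>t. T \<le> t \<Longrightarrow> u t \<noteq> y"
  shows "eventually (\<lambda>t. u t \<le> y) at_top \<or> eventually (\<lambda>t. y \<le> u t) at_top"
proof (rule ccontr)
  assume "\<not> ?thesis"
  then have "\<not> (\<forall>t\<ge>T. u t \<le> y)" "\<not> (\<forall>t\<ge>T. y \<le> u t)"
    unfolding eventually_at_top_linorder by blast+
  then obtain t1 t2 where t: "T \<le> t1" "y < u t1" "T \<le> t2" "u t2 < y" by (auto simp: not_le)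
  have "connected (u ` {T..})" by (rule connected_continuous_image[OF cont]) simp
  then have "y \<in> u ` {T..}"
    by (rule connectedD_interval[of _ "u t2" "u t1"]) (use t in auto)
  then show False using ne by auto
qed

lemma uniformly_continuous_if_bounded_derivative:
  fixes f f' :: "real \<Rightarrow> real"
  assumes f': "\<And>t. t0 < t \<Longrightarrow> (f has_real_derivative f' t) (at t)" and bdd: "\<And>t. t0 < t \<Longrightarrow> \<bar>f' t\<bar> \<le> B"
  shows "uniformly_continuous_on {t0<..} f"
proof (rule lipschitz_on_uniformly_continuous[of "\<bar>B\<bar>"])
  show "\<bar>B\<bar>-lipschitz_on {t0<..} f"
  proof (rule lipschitz_onI)
    fix u v assume uv: "u \<in> {t0<..}" "v \<in> {t0<..}"
    have "norm (f u - f v) \<le> \<bar>B\<bar> * norm (u - v)"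
    proof (rule field_differentiable_bound[of "{t0<..}" f f'])
      show "(f has_field_derivative f' z) (at z within {t0<..})" if "z \<in> {t0<..}" for z
        by (rule has_field_derivative_at_within[OF f']) (use that in simp)
      show "norm (f' z) \<le> \<bar>B\<bar>" if "z \<in> {t0<..}" for z using bdd[of z] that by auto
    qed (use uv in auto)
    then show "dist (f u) (f v) \<le> \<bar>B\<bar> * dist u v" by (simp only: dist_norm)
  qed simp
qed

context planar_system
begin

text \<open>The derivative in \<open>y\<close> is a power of \<open>y\<close> times an affine
  function of nonzero slope, which cannot vanish at two points. This lets convergence of
  \<open>V g (Y t)\<close> be turned into convergence of \<open>Y\<close>.\<close>

lemma V_g_nonconstant:
  assumes "0 \<le> y1" "y1 < y2"
  shows "\<exists>y. y1 < y \<and> y < y2 \<and> V g y \<noteq> L"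
proof (rule ccontr)
  assume "\<not> ?thesis"
  then have const: "V g y = L" if "y1 < y" "y < y2" for y using that by auto
  define a where "a = p / k"
  have "0 < a" using k_pos p_gt_1 by (simp add: a_def)
  have lin: "a * P g + (a + 1) * (y / (q + 1)) = 0" if y: "y1 < y" "y < y2" for y
  proof -
    have "0 < y" using y assms by simp
    have "((\<lambda>y. y powr a * (P g + y / (q + 1))) has_real_derivative
        a * y powr (a - 1) * (P g + y / (q + 1)) + 1 / (q + 1) * y powr a) (at y)"
      using q_gt p_gt_1 \<open>0 < y\<close> by (auto intro!: derivative_eq_intros)
    moreover have "((\<lambda>y. y powr a * (P g + y / (q + 1))) has_real_derivative 0) (at y)"
    proof (rule has_field_derivative_transform_within_open[of "\<lambda>_. L" 0 _ "{y1<..<y2}"])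
      show "L = z powr a * (P g + z / (q + 1))" if "z \<in> {y1<..<y2}" for z
        using const[of z] that by (simp add: V_def a_def)
    qed (use y in auto)
    ultimately have "a * y powr (a - 1) * (P g + y / (q + 1)) + 1 / (q + 1) * y powr a = 0"
      by (rule DERIV_unique)
    moreover have "y powr a = y * y powr (a - 1)" using powr_add[of y 1 "a - 1"] \<open>0 < y\<close> by simp
    ultimately have "y powr (a - 1) * (a * P g + (a + 1) * (y / (q + 1))) = 0"
      by (simp add: algebra_simps add_divide_distrib)
    then show ?thesis using \<open>0 < y\<close> by simp
  qed
  define z where "z = (y1 + y2) / 2"
  define z' where "z' = (y1 + z) / 2"
  have "y1 < z" "z < y2" "y1 < z'" "z' < y2" "z' < z" using assms by (auto simp: z_def z'_def field_simps)
  moreover from this have "(a + 1) * (z / (q + 1)) = (a + 1) * (z' / (q + 1))"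
    using lin[of z] lin[of z'] by linarith
  moreover have "q + 1 \<noteq> 0" "a + 1 \<noteq> 0" using \<open>0 < a\<close> q_gt p_gt_1 by auto
  ultimately show False by simp
qed

text \<open>That \<open>W\<close> tends to \<open>0\<close> only says that the solution approaches
  the union of the line \<open>x = g\<close> and the axis. \<open>Y\<close> is shown to converge
  first; a positive limit forces \<open>x\<close> to \<open>g\<close>, and with limit
  \<open>0\<close> the nearly one-dimensional equation for \<open>x\<close> decides.\<close>

lemma bounded_flow_converges:
  assumes "c \<noteq> 0" and fl: "flow 1 {t0<..} x Y" and "0 < \<delta>"
    and x: "\<And>t. t0 < t \<Longrightarrow> \<delta> \<le> x t \<and> x t \<le> b" and Y: "\<And>t. t0 < t \<Longrightarrow> 0 < Y t \<and> Y t \<le> M"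
  shows "(x \<longlongrightarrow> g) at_top \<and> (Y \<longlongrightarrow> h N p g - \<mu>) at_top \<and> \<mu> < h N p g \<or>
    (\<exists>\<nu>. (\<nu> = \<nu>m \<or> \<nu> = \<nu>p) \<and> (x \<longlongrightarrow> \<nu>) at_top \<and> (Y \<longlongrightarrow> 0) at_top)"
proof -
  define K where "K = {\<delta>..b} \<times> {0..M}"
  have K: "compact K" "K \<subseteq> {0<..} \<times> {0..}" "K \<subseteq> {0<..} \<times> UNIV"
    using \<open>0 < \<delta>\<close> by (auto simp: K_def intro: compact_Times)
  have inK: "(x t, Y t) \<in> K" if "t0 < t" for t using x[OF that] Y[OF that] by (auto simp: K_def)
  have pos: "0 < x t \<and> 0 < Y t" if "t0 < t" for t using x[OF that] Y[OF that] \<open>0 < \<delta>\<close> by auto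
  have x': "(x has_real_derivative F (x t) (Y t)) (at t)"
    and Y': "(Y has_real_derivative G (x t) (Y t)) (at t)" if "t0 < t" for t
    using fl that by (auto simp: flow_def)
  have after: "eventually (\<lambda>t. t0 < t) at_top" by (rule eventually_gt_at_top)
  have bounded: "\<exists>B. \<forall>t>t0. \<bar>f (x t, Y t)\<bar> \<le> B" if "continuous_on K f" for f :: "real \<times> real \<Rightarrow> real"
  proof -
    have "bounded (f ` K)" using that K(1) by (intro compact_imp_bounded compact_continuous_image)
    then show ?thesis using inK unfolding bounded_iff real_norm_def by blast
  qed
  have contV: "continuous_on K (\<lambda>z. V (fst z) (snd z))"
    and contW: "continuous_on K (\<lambda>z. W (fst z) (snd z))"
    and contF: "continuous_on K (\<lambda>z. F (fst z) (snd z))"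
    using K V_continuous_on W_continuous_on F_continuous_on by (auto intro: continuous_on_subset)
  have contG: "continuous_on K (\<lambda>z. G (fst z) (snd z))"
    unfolding G_def by (intro continuous_intros)

  have V': "((\<lambda>t. V (x t) (Y t)) has_real_derivative - c * W (x t) (Y t)) (at t)" if "t0 < t" for t
    using V_flow[OF fl] that pos[OF that] by auto
  obtain L where L: "((\<lambda>t. V (x t) (Y t)) \<longlongrightarrow> L) at_top"
  proof -
    obtain B where B: "\<And>t. t0 < t \<Longrightarrow> \<bar>V (x t) (Y t)\<bar> \<le> B" using bounded[OF contV] by auto
    have "c * V (x t) (Y t) \<le> c * V (x u) (Y u)" if "t0 < u" "u \<le> t" for u t
    proof (rule DERIV_nonpos_imp_nonincreasing[where f = "\<lambda>t. c * V (x t) (Y t)", OF that(2)])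
      fix v assume "u \<le> v" "v \<le> t"
      then have v: "t0 < v" using that by simp
      have "((\<lambda>t. c * V (x t) (Y t)) has_real_derivative - (c\<^sup>2 * W (x v) (Y v))) (at v)"
        by (rule DERIV_cong[OF DERIV_cmult[OF V'[OF v]]]) (simp add: power2_eq_square)
      moreover have "- (c\<^sup>2 * W (x v) (Y v)) \<le> 0" using W_nonneg[of "x v" "Y v"] pos[OF v] by simp
      ultimately show "\<exists>d. ((\<lambda>t. c * V (x t) (Y t)) has_real_derivative d) (at v) \<and> d \<le> 0" by blast
    qed
    moreover have "- (\<bar>c\<bar> * B) \<le> c * V (x t) (Y t)" if "t0 < t" for t
    proof -
      have "\<bar>c * V (x t) (Y t)\<bar> \<le> \<bar>c\<bar> * B" unfolding abs_mult by (intro mult_left_mono B that) simp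
      then show ?thesis by linarith
    qed
    ultimately obtain l where "((\<lambda>t. c * V (x t) (Y t)) \<longlongrightarrow> l) at_top"
      by (rule antimono_bounded_tendsto)
    then have "((\<lambda>t. c * V (x t) (Y t) / c) \<longlongrightarrow> l / c) at_top"
      using \<open>c \<noteq> 0\<close> by (intro tendsto_divide tendsto_const)
    then show thesis using that \<open>c \<noteq> 0\<close> by simp
  qed

  \<comment> \<open>Barbalat needs \<open>- c * W\<close> uniformly continuous in time:
    \<open>x\<close> and \<open>Y\<close> have bounded derivatives, and \<open>W\<close> is
    uniformly continuous on the compact \<open>K\<close>.\<close>
  have Wlim: "((\<lambda>t. W (x t) (Y t)) \<longlongrightarrow> 0) at_top"
  proof -
    obtain BF where "\<And>t. t0 < t \<Longrightarrow> \<bar>F (x t) (Y t)\<bar> \<le> BF" using bounded[OF contF] by auto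
    then have ucx: "uniformly_continuous_on {t0<..} x"
      by (intro uniformly_continuous_if_bounded_derivative[OF x'])
    obtain BG where "\<And>t. t0 < t \<Longrightarrow> \<bar>G (x t) (Y t)\<bar> \<le> BG" using bounded[OF contG] by auto
    then have ucY: "uniformly_continuous_on {t0<..} Y"
      by (intro uniformly_continuous_if_bounded_derivative[OF Y'])
    have "uniformly_continuous_on {t0<..} (\<lambda>t. (x t, Y t))"
      unfolding uniformly_continuous_on_sequentially
    proof (intro allI impI, elim conjE)
      fix u v :: "nat \<Rightarrow> real"
      assume "\<forall>n. u n \<in> {t0<..}" "\<forall>n. v n \<in> {t0<..}" "(\<lambda>n. dist (u n) (v n)) \<longlonglongrightarrow> 0"
      then have "(\<lambda>n. dist (x (u n)) (x (v n))) \<longlonglongrightarrow> 0" "(\<lambda>n. dist (Y (u n)) (Y (v n))) \<longlonglongrightarrow> 0"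
        using ucx ucY unfolding uniformly_continuous_on_sequentially by blast+
      then have "(\<lambda>n. sqrt ((dist (x (u n)) (x (v n)))\<^sup>2 + (dist (Y (u n)) (Y (v n)))\<^sup>2)) \<longlonglongrightarrow> sqrt (0\<^sup>2 + 0\<^sup>2)"
        by (intro tendsto_intros)
      then show "(\<lambda>n. dist (x (u n), Y (u n)) (x (v n), Y (v n))) \<longlonglongrightarrow> 0"
        by (simp add: dist_Pair_Pair)
    qed
    moreover have "uniformly_continuous_on K (\<lambda>z. - c * W (fst z) (snd z))"
      using contW K(1) by (intro compact_uniformly_continuous continuous_intros)
    then have "uniformly_continuous_on ((\<lambda>t. (x t, Y t)) ` {t0<..}) (\<lambda>z. - c * W (fst z) (snd z))"
      unfolding uniformly_continuous_on_def using inK by (fastforce simp del: split_paired_All)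
    ultimately have "uniformly_continuous_on {t0<..} (\<lambda>t. - c * W (x t) (Y t))"
      using uniformly_continuous_on_compose[of "{t0<..}" "\<lambda>t. (x t, Y t)" "\<lambda>z. - c * W (fst z) (snd z)"]
      by simp
    then have "((\<lambda>t. - c * W (x t) (Y t)) \<longlongrightarrow> 0) at_top"
      by (intro barbalat[where f = "\<lambda>t. V (x t) (Y t)", OF _ L] V')
    then have "((\<lambda>t. - c * W (x t) (Y t) / - c) \<longlongrightarrow> 0 / - c) at_top"
      using \<open>c \<noteq> 0\<close> by (intro tendsto_divide tendsto_const) auto
    then show ?thesis using \<open>c \<noteq> 0\<close> by simp
  qed

  \<comment> \<open>Where \<open>W\<close> vanishes, either \<open>x = g\<close> or
    \<open>Y = 0\<close>, and on the axis both values of \<open>V\<close> are \<open>0\<close>.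
    Hence the limit of \<open>V\<close> becomes a statement about \<open>Y\<close> alone.\<close>
  have "((\<lambda>t. V (x t) (Y t) - V g (Y t)) \<longlongrightarrow> 0) at_top"
  proof -
    have "continuous_on K (\<lambda>z. V (fst z) (snd z) - V g (snd z))"
      unfolding V_def[of g] using K k_pos p_gt_1
      by (intro continuous_intros continuous_on_powr' contV) auto
    moreover have "V (fst z) (snd z) - V g (snd z) = 0" if "z \<in> K" "W (fst z) (snd z) = 0" for z
      using that K(2) W_eq_0_iff[of "fst z" "snd z"] V_axis by (cases "snd z = 0") (auto simp: mem_Times_iff)
    ultimately show ?thesis
      using tendsto_zero_on_compact[OF K(1) _ contW, of "\<lambda>z. V (fst z) (snd z) - V g (snd z)" "\<lambda>t. (x t, Y t)" at_top]
        Wlim eventually_mono[OF after inK] by simp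
  qed
  from tendsto_diff[OF L this] have phi: "((\<lambda>t. V g (Y t)) \<longlongrightarrow> L) at_top" by simp

  have contY: "continuous_on {T..} Y" if "t0 < T" for T
  proof -
    have "{T..} \<subseteq> {t0<..}" using that by auto
    then show ?thesis using flow_continuous[OF fl] by blast
  qed
  obtain Y0 where Y0: "Y0 \<in> {0..M}" "(Y \<longlongrightarrow> Y0) at_top"
  proof (rule tendsto_if_levels_eventually_one_sided[of t0 Y 0 M])
    show "Y t \<in> {0..M}" if "t0 < t" for t using Y[OF that] by auto
    fix y1 y2 :: real assume "y1 < y2" "0 \<le> y1"
    then obtain y where y: "y1 < y" "y < y2" "V g y \<noteq> L" using V_g_nonconstant by blast
    \<comment> \<open>A level \<open>y\<close> with \<open>V g y\<close> different from
      \<open>L\<close> is not taken by \<open>Y\<close> at late times, so by continuity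
      \<open>Y\<close> stays on one side of it.\<close>
    have "eventually (\<lambda>t. V g (Y t) \<noteq> V g y) at_top"
      using tendsto_imp_eventually_ne[OF phi] y(3) by auto
    then obtain T where T: "\<And>t. T \<le> t \<Longrightarrow> V g (Y t) \<noteq> V g y" unfolding eventually_at_top_linorder by blast
    have "eventually (\<lambda>t. Y t \<le> y) at_top \<or> eventually (\<lambda>t. y \<le> Y t) at_top"
      by (rule one_sided_if_avoids[OF contY[of "max T (t0 + 1)"]]) (use T in auto)
    then show "\<exists>y. y1 < y \<and> y < y2 \<and> (eventually (\<lambda>t. Y t \<le> y) at_top \<or> eventually (\<lambda>t. y \<le> Y t) at_top)"
      using y by auto
  qed

  have equilibrium_limit: "F x0 Y0 = 0" if "(x \<longlongrightarrow> x0) at_top" "0 < x0" for x0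
    using derivative_limit_zero[OF x' that(1) F_tendsto[OF that(1) Y0(2) that(2)]] .
  show ?thesis
  proof (cases "Y0 = 0")
    case False
    then have "0 < Y0" using Y0(1) by auto
    \<comment> \<open>Away from the axis the zeros of \<open>W\<close> are exactly the points with
      \<open>x = g\<close>.\<close>
    define K' where "K' = {\<delta>..b} \<times> {Y0 / 2..M}"
    have K': "compact K'" "K' \<subseteq> K" using \<open>0 < Y0\<close> by (auto simp: K'_def K_def intro: compact_Times)
    have "eventually (\<lambda>t. Y0 / 2 < Y t) at_top" using Y0(2) \<open>0 < Y0\<close> by (intro order_tendstoD) auto
    then have "eventually (\<lambda>t. (x t, Y t) \<in> K') at_top"
      using after by eventually_elim (use x Y in \<open>auto simp: K'_def\<close>)
    moreover have "fst z - g = 0" if "z \<in> K'" "W (fst z) (snd z) = 0" for z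
      using that W_eq_0_iff[of "fst z" "snd z"] \<open>0 < Y0\<close> \<open>0 < \<delta>\<close> by (auto simp: K'_def mem_Times_iff)
    ultimately have "((\<lambda>t. fst (x t, Y t) - g) \<longlongrightarrow> 0) at_top"
      using Wlim continuous_on_subset[OF contW K'(2)]
      by (intro tendsto_zero_on_compact[OF K'(1), of "\<lambda>z. fst z - g" "\<lambda>z. W (fst z) (snd z)"] continuous_intros) auto
    then have "(x \<longlongrightarrow> g) at_top" using LIM_zero_cancel[of x g at_top] by simp
    moreover have "F g Y0 = 0" by (rule equilibrium_limit[OF \<open>(x \<longlongrightarrow> g) at_top\<close> g_pos])
    then have "Y0 = h N p g - \<mu>" using g_pos p_gt_1 by (simp add: F_def)
    ultimately show ?thesis using Y0(2) \<open>0 < Y0\<close> by auto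
  next
    case True
    obtain x0 where x0: "x0 \<in> {\<delta>..b}" "(x \<longlongrightarrow> x0) at_top"
    proof (rule tendsto_if_levels_eventually_one_sided[of t0 x \<delta> b])
      show "x t \<in> {\<delta>..b}" if "t0 < t" for t using x[OF that] by auto
      fix y1 y2 :: real assume y12: "y1 < y2" "\<delta> \<le> y1"
      have "infinite {y1<..<y2}" using y12 by simp
      then have "\<not> {y1<..<y2} \<subseteq> {\<nu>m, \<nu>p}" by (metis finite.emptyI finite.insertI finite_subset)
      then have "\<exists>y. y \<in> {y1<..<y2} \<and> y \<notin> {\<nu>m, \<nu>p}" by blast
      then obtain y where y: "y1 < y" "y < y2" "y \<noteq> \<nu>m" "y \<noteq> \<nu>p"
        unfolding greaterThanLessThan_iff insert_iff empty_iff by metis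
      then have "0 < y" using y12 \<open>0 < \<delta>\<close> by simp
      have ne: "F y 0 \<noteq> 0" using h_eq_iff[OF \<open>0 < y\<close>] y \<open>0 < y\<close> p_gt_1 by (auto simp: F_def)
      have lim: "((\<lambda>t. F y (Y t)) \<longlongrightarrow> F y 0) at_top"
        using F_tendsto[OF tendsto_const Y0(2) \<open>0 < y\<close>] True by simp
      \<comment> \<open>As \<open>y\<close> is not a root, \<open>F y 0\<close> is nonzero, and
        \<open>F y (Y t)\<close> eventually has its sign. From then on \<open>x\<close> can cross
        the level \<open>y\<close> in one direction only.\<close>
      have "eventually (\<lambda>t. x t \<le> y) at_top \<or> eventually (\<lambda>t. y \<le> x t) at_top"
      proof (cases "0 < F y 0")
        case True
        then have "eventually (\<lambda>t. 0 < F y (Y t)) at_top" using lim by (intro order_tendstoD)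
        then obtain T where T: "\<And>t. T \<le> t \<Longrightarrow> 0 < F y (Y t)" unfolding eventually_at_top_linorder by blast
        show ?thesis
        proof (cases "\<exists>t1\<ge>max T (t0 + 1). y < x t1")
          case True
          then obtain t1 where t1: "max T (t0 + 1) \<le> t1" "y < x t1" by auto
          have "0 < x t - y" if "t1 \<le> t" for t
          proof (rule positive_preserved_if_increasing_at_zeros[of t1 "\<lambda>t. x t - y" "\<lambda>t. F (x t) (Y t)" t])
            show "((\<lambda>t. x t - y) has_real_derivative F (x t) (Y t)) (at t)" if "t1 \<le> t" for t
              using x'[of t] that t1(1) by (auto intro!: derivative_eq_intros)
            show "0 < F (x t) (Y t)" if "t1 \<le> t" "x t - y = 0" for t
              using T[of t] that t1(1) by simp
          qed (use t1 that in auto)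
          then show ?thesis by (intro disjI2 eventually_at_top_linorderI[of t1]) fastforce
        next
          case False
          then show ?thesis
            by (intro disjI1 eventually_at_top_linorderI[of "max T (t0 + 1)"]) (auto simp: not_less)
        qed
      next
        case False
        then have "F y 0 < 0" using ne by simp
        then have "eventually (\<lambda>t. F y (Y t) < 0) at_top" using lim by (intro order_tendstoD)
        then obtain T where T: "\<And>t. T \<le> t \<Longrightarrow> F y (Y t) < 0" unfolding eventually_at_top_linorder by blast
        show ?thesis
        proof (cases "\<exists>t1\<ge>max T (t0 + 1). x t1 < y")
          case True
          then obtain t1 where t1: "max T (t0 + 1) \<le> t1" "x t1 < y" by auto
          have "0 < y - x t" if "t1 \<le> t" for t
          proof (rule positive_preserved_if_increasing_at_zeros[of t1 "\<lambda>t. y - x t" "\<lambda>t. - F (x t) (Y t)" t])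
            show "((\<lambda>t. y - x t) has_real_derivative - F (x t) (Y t)) (at t)" if "t1 \<le> t" for t
              using x'[of t] that t1(1) by (auto intro!: derivative_eq_intros)
            show "0 < - F (x t) (Y t)" if "t1 \<le> t" "y - x t = 0" for t
              using T[of t] that t1(1) by simp
          qed (use t1 that in auto)
          then show ?thesis by (intro disjI1 eventually_at_top_linorderI[of t1]) fastforce
        next
          case False
          then show ?thesis
            by (intro disjI2 eventually_at_top_linorderI[of "max T (t0 + 1)"]) (auto simp: not_less)
        qed
      qed
      then show "\<exists>y. y1 < y \<and> y < y2 \<and> (eventually (\<lambda>t. x t \<le> y) at_top \<or> eventually (\<lambda>t. y \<le> x t) at_top)"
        using y by blast
    qed
    have "0 < x0" using x0(1) \<open>0 < \<delta>\<close> by simp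
    then have "F x0 0 = 0" using equilibrium_limit[OF x0(2)] True by simp
    then have "x0 = \<nu>m \<or> x0 = \<nu>p" using h_eq_iff[OF \<open>0 < x0\<close>] \<open>0 < x0\<close> p_gt_1 by (auto simp: F_def)
    then show ?thesis using x0(2) Y0(2) True by blast
  qed
qed

end

section \<open>Divergence and Hamiltonian structure\<close>

text \<open>Both components of the weighted field and the Hamiltonian are sums of products of a
  function of \<open>x\<close> and a function of \<open>Y\<close>, so this supplies all their
  derivatives.\<close>

lemma separated_product_has_derivative:
  fixes A B :: "real \<Rightarrow> real"
  assumes "(A has_real_derivative a) (at x)" "(B has_real_derivative b) (at y)"
  shows "((\<lambda>z. A (fst z) * B (snd z)) has_derivative (\<lambda>w. a * B y * fst w + A x * b * snd w)) (at (x, y))"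
proof -
  have "((\<lambda>z. A (fst z)) has_derivative (\<lambda>w. a * fst w)) (at (x, y))"
    using has_derivative_compose[OF has_derivative_fst[OF has_derivative_ident], of A "(*) a" "(x, y)" UNIV] assms(1)
    by (simp add: has_field_derivative_def)
  moreover have "((\<lambda>z. B (snd z)) has_derivative (\<lambda>w. b * snd w)) (at (x, y))"
    using has_derivative_compose[OF has_derivative_snd[OF has_derivative_ident], of B "(*) b" "(x, y)" UNIV] assms(2)
    by (simp add: has_field_derivative_def)
  ultimately have "((\<lambda>z. A (fst z) * B (snd z)) has_derivative
      (\<lambda>w. A (fst (x, y)) * (b * snd w) + a * fst w * B (snd (x, y)))) (at (x, y))"
    by (rule has_derivative_mult)
  then show ?thesis by (simp add: mult_ac add.commute)
qed

context planar_system
begin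

abbreviation "b \<equiv> dulac_b N p s"

lemma b_gt: "- 1 < b"
  using p_less_N s_gt by (simp add: dulac_b_def)

text \<open>The reason for the choice of \<open>b\<close>: in the divergence this identity cancels
  the terms of order \<open>x powr (p - 2)\<close> and leaves a single power of
  \<open>x\<close>.\<close>

lemma k_b_g: "k * (b + 1) * g = N - p"
  using k_g s_gt by (simp add: dulac_b_def mult.commute mult.left_commute)

lemma k_c: "k * c = (N - p) * (q + 1 - p_star N p s)"
proof -
  have "(N - p) * p_star N p s = p * (N + s)" using p_less_N by (simp add: p_star_def)
  then have "(N - p) * (q + 1 - p_star N p s) = (N - p) * (q + 1) - p * (N + s)"
    by (simp add: right_diff_distrib)
  moreover have "k * c = k * (N - p) - p * (k * g)" by (simp add: c_def algebra_simps)
  ultimately show ?thesis unfolding k_g by (simp add: algebra_simps)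
qed

lemma c_sign: "0 < c \<longleftrightarrow> p_star N p s - 1 < q" "c = 0 \<longleftrightarrow> q = p_star N p s - 1" "c < 0 \<longleftrightarrow> q < p_star N p s - 1"
proof -
  have "0 < k * c \<longleftrightarrow> 0 < (N - p) * (q + 1 - p_star N p s)" "k * c < 0 \<longleftrightarrow> (N - p) * (q + 1 - p_star N p s) < 0"
    by (simp_all only: k_c)
  then show *: "0 < c \<longleftrightarrow> p_star N p s - 1 < q" "c < 0 \<longleftrightarrow> q < p_star N p s - 1"
    using k_pos p_less_N by (auto simp: zero_less_mult_iff mult_less_0_iff)
  show "c = 0 \<longleftrightarrow> q = p_star N p s - 1" using * by linarith
qed

text \<open>The divergence has the same factor \<open>- c\<close> as the derivative of
  \<open>V\<close>, so both change sign at the critical exponent.\<close>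

lemma dulac_div_eq: "dulac_div N p s q x Y = - (c / g) * (x powr (p - 1) * Y powr b)"
proof -
  have "p - (N - p) / g = - (c / g)" using g_pos by (simp add: c_def field_simps)
  then show ?thesis by (simp add: dulac_div_def g_def)
qed

lemma weighted_field_eq:
  assumes "0 < x" "0 < Y"
  shows "weighted_field N p s \<mu> q (x, Y) =
    ((\<mu> - h N p x) / (p - 1) * Y powr b + 1 / (p - 1) * Y powr (b + 1),
     k * x powr (p - 2) * (g - x) * Y powr (b + 1))"
proof -
  have Y: "Y powr (1 + b) = Y * Y powr b" using assms by (simp add: powr_add)
  have "x powr (p - 2) * Y powr b * F x Y = Y powr b * (\<mu> + Y - h N p x) / (p - 1)"
    using assms by (simp add: F_def powr_reduce)
  then show ?thesis
    by (simp add: weighted_field_def dulac_B_def field_eq G_def Y add.commute[of b 1]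
        add_divide_distrib diff_divide_distrib algebra_simps)
qed

lemma weighted_field_divergence:
  assumes x: "0 < x" and Y: "0 < Y"
  shows "has_divergence (weighted_field N p s \<mu> q) (dulac_div N p s q x Y) (x, Y)"
proof -
  define f1 where "f1 z = (\<mu> - h N p (fst z)) / (p - 1) * snd z powr b + 1 / (p - 1) * snd z powr (b + 1)" for z
  define f2 where "f2 z = k * fst z powr (p - 2) * (g - fst z) * snd z powr (b + 1)" for z
  define a2 where "a2 = k * (p - 2) * x powr (p - 3) * (g - x) - k * x powr (p - 2)"
  have B: "((\<lambda>y. y powr r) has_real_derivative r * Y powr (r - 1)) (at Y)" for r
    using has_real_derivative_powr[OF Y] by simp
  have A1: "((\<lambda>x. (\<mu> - h N p x) / (p - 1)) has_real_derivative - dh x / (p - 1)) (at x)"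
    by (rule derivative_eq_intros x refl DERIV_cdivide)+ simp
  have A2: "((\<lambda>x. k * x powr (p - 2) * (g - x)) has_real_derivative a2) (at x)"
    unfolding a2_def by (rule derivative_eq_intros x refl)+ (simp add: algebra_simps)
  have d1: "(f1 has_derivative (\<lambda>w. (- dh x / (p - 1) * Y powr b * fst w + (\<mu> - h N p x) / (p - 1) * (b * Y powr (b - 1)) * snd w)
      + (0 * Y powr (b + 1) * fst w + 1 / (p - 1) * ((b + 1) * Y powr (b + 1 - 1)) * snd w))) (at (x, Y))"
    unfolding f1_def
    by (intro has_derivative_add separated_product_has_derivative[OF A1 B] separated_product_has_derivative[OF DERIV_const B])
  have d2: "(f2 has_derivative (\<lambda>w. a2 * Y powr (b + 1) * fst w
      + k * x powr (p - 2) * (g - x) * ((b + 1) * Y powr (b + 1 - 1)) * snd w)) (at (x, Y))"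
    unfolding f2_def by (rule separated_product_has_derivative[OF A2 B])
  note d = has_derivative_Pair[OF d1 d2]
  \<comment> \<open>The separated formula holds only in the open quadrant, so differentiability is
    transferred locally.\<close>
  have "open ({0<..} \<times> {0<..} :: (real \<times> real) set)" by (intro open_Times) auto
  then have wd: "(weighted_field N p s \<mu> q has_derivative (\<lambda>w.
      ((- dh x / (p - 1) * Y powr b * fst w + (\<mu> - h N p x) / (p - 1) * (b * Y powr (b - 1)) * snd w)
      + (0 * Y powr (b + 1) * fst w + 1 / (p - 1) * ((b + 1) * Y powr (b + 1 - 1)) * snd w),
      a2 * Y powr (b + 1) * fst w
      + k * x powr (p - 2) * (g - x) * ((b + 1) * Y powr (b + 1 - 1)) * snd w))) (at (x, Y))"
    by (rule has_derivative_transform_within_open[OF d])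
      (use x Y in \<open>auto simp: weighted_field_eq f1_def f2_def\<close>)
  have dh: "- dh x / (p - 1) = - (x powr (p - 2) * (N - p - p * x))" using p_gt_1 by (simp add: dh_def)
  have "- dh x / (p - 1) * Y powr b + k * x powr (p - 2) * (g - x) * ((b + 1) * Y powr b)
      = x powr (p - 2) * Y powr b * (k * (b + 1) * g - (N - p) + (p - k * (b + 1)) * x)"
    unfolding dh by (simp add: algebra_simps)
  also have "\<dots> = (p - k * (b + 1)) * x powr (p - 1) * Y powr b"
    unfolding k_b_g using x by (simp add: powr_reduce)
  also have "k * (b + 1) = (N - p) / g" using k_b_g g_pos by (simp add: eq_divide_eq)
  finally have eq: "dulac_div N p s q x Y =
      - dh x / (p - 1) * Y powr b + k * x powr (p - 2) * (g - x) * ((b + 1) * Y powr b)"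
    by (simp add: dulac_div_def g_def)
  show ?thesis
    unfolding has_divergence_def by (intro exI conjI, rule wd) (simp add: eq)
qed

text \<open>Criticality enters through \<open>p * g = N - p\<close> and
  \<open>k * (b + 1) = p\<close>, which turn \<open>dh\<close> into the multiple of
  \<open>g - x\<close> that \<open>G\<close> requires. The derivative in \<open>Y\<close> matches by
  the choice of the two denominators.\<close>

lemma hamiltonian_has_derivative:
  assumes crit: "c = 0" and x: "0 < x" and Y: "0 < Y"
  shows "(hamiltonian N p s \<mu> has_derivative (\<lambda>w.
    - snd (weighted_field N p s \<mu> q (x, Y)) * fst w + fst (weighted_field N p s \<mu> q (x, Y)) * snd w)) (at (x, Y))"
proof -
  have pg: "p * g = N - p" using crit by (simp add: c_def)
  then have "k * (b + 1) * g = p * g" using k_b_g by simp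
  then have kb: "k * (b + 1) = p" using g_pos by simp
  have b1: "b + 1 \<noteq> 0" "b + 2 \<noteq> 0" using b_gt by auto
  have Yb: "Y powr (1 + b) = Y * Y powr b" using Y by (simp add: powr_add)
  have A: "((\<lambda>x. (\<mu> - h N p x) / ((p - 1) * (b + 1))) has_real_derivative - dh x / ((p - 1) * (b + 1))) (at x)"
    by (rule derivative_eq_intros x refl DERIV_cdivide)+ simp
  have B1: "((\<lambda>y. y powr (b + 1)) has_real_derivative (b + 1) * Y powr b) (at Y)"
    using has_real_derivative_powr[OF Y, of "b + 1"] by simp
  have B2: "((\<lambda>y. y powr (b + 1) * y) has_real_derivative (b + 2) * Y powr (b + 1)) (at Y)"
    by (rule DERIV_cong[OF DERIV_mult[OF B1 DERIV_ident]]) (simp add: Yb add.commute[of b 1] algebra_simps)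
  have ham: "hamiltonian N p s \<mu> = (\<lambda>z. (\<mu> - h N p (fst z)) / ((p - 1) * (b + 1)) * snd z powr (b + 1)
      + 1 / ((p - 1) * (b + 2)) * (snd z powr (b + 1) * snd z))"
    by (auto simp: hamiltonian_def fun_eq_iff algebra_simps add_divide_distrib)
  have d: "((\<lambda>z. (\<mu> - h N p (fst z)) / ((p - 1) * (b + 1)) * snd z powr (b + 1)
      + 1 / ((p - 1) * (b + 2)) * (snd z powr (b + 1) * snd z)) has_derivative
      (\<lambda>w. (- dh x / ((p - 1) * (b + 1)) * Y powr (b + 1) * fst w
        + (\<mu> - h N p x) / ((p - 1) * (b + 1)) * ((b + 1) * Y powr b) * snd w)
        + (0 * (Y powr (b + 1) * Y) * fst w + 1 / ((p - 1) * (b + 2)) * ((b + 2) * Y powr (b + 1)) * snd w))) (at (x, Y))"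
    by (intro has_derivative_add separated_product_has_derivative[OF A B1] separated_product_has_derivative[OF DERIV_const B2])
  have e1: "- dh x / ((p - 1) * (b + 1)) = - (k * x powr (p - 2) * (g - x))"
  proof -
    have "N - p - p * x = p * (g - x)" using pg by (simp add: right_diff_distrib)
    then have "dh x = (p - 1) * x powr (p - 2) * (p * (g - x))" by (simp add: dh_def)
    also have "\<dots> = ((p - 1) * (b + 1)) * (k * x powr (p - 2) * (g - x))"     proof -
      have "((p - 1) * (b + 1)) * (k * x powr (p - 2) * (g - x)) = (p - 1) * x powr (p - 2) * (k * (b + 1) * (g - x))"
        by (simp only: mult_ac)
      then show ?thesis by (simp only: kb)
    qed
    finally show ?thesis using b1 p_gt_1 by simp
  qed
  have e2: "(\<mu> - h N p x) / ((p - 1) * (b + 1)) * ((b + 1) * Y powr b) = (\<mu> - h N p x) / (p - 1) * Y powr b"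
    and e3: "1 / ((p - 1) * (b + 2)) * ((b + 2) * Y powr (b + 1)) = 1 / (p - 1) * Y powr (b + 1)"
    using b1 by simp_all
  show ?thesis
    unfolding ham
    by (rule has_derivative_eq_rhs[OF d[unfolded e1 e2 e3]])
      (simp add: weighted_field_eq[OF x Y] fun_eq_iff distrib_right left_diff_distrib)
qed

lemma hamiltonian_on_quadrant:
  assumes "c = 0"
  shows "hamiltonian_on ({0<..} \<times> {0<..}) (hamiltonian N p s \<mu>) (weighted_field N p s \<mu> q)"
  unfolding hamiltonian_on_def
proof (intro allI impI)
  fix x Y :: real assume "(x, Y) \<in> {0<..} \<times> {0<..}"
  then have x: "0 < x" and Y: "0 < Y" by auto
  note d = hamiltonian_has_derivative[OF assms x Y]
  have lines: "((\<lambda>\<eta>. (x, \<eta>)) has_derivative (\<lambda>t. (0, t))) (at Y)" "((\<lambda>\<xi>. (\<xi>, Y)) has_derivative (\<lambda>t. (t, 0))) (at x)"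
    by (auto intro!: derivative_eq_intros)
  have neg: "(*) (- a) = (\<lambda>r. - (a * r))" for a :: real by auto
  from has_derivative_compose[OF lines(1) d] has_derivative_compose[OF lines(2) d] d
  show "hamiltonian N p s \<mu> differentiable at (x, Y) \<and>
    ((\<lambda>\<eta>. hamiltonian N p s \<mu> (x, \<eta>)) has_real_derivative fst (weighted_field N p s \<mu> q (x, Y))) (at Y) \<and>
    ((\<lambda>\<xi>. hamiltonian N p s \<mu> (\<xi>, Y)) has_real_derivative - snd (weighted_field N p s \<mu> q (x, Y))) (at x)"
    by (auto simp: has_field_derivative_def differentiable_def neg)
qed

lemma hamiltonian_first_integral:
  assumes "c = 0"
  shows "first_integral_on ({0<..} \<times> {0<..}) (hamiltonian N p s \<mu>) (field N p s \<mu> q)"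
  unfolding first_integral_on_def
proof (intro allI impI, elim conjE)
  fix T \<gamma> assume T: "is_interval T" and sol: "solution_on (field N p s \<mu> q) T \<gamma>" and sub: "\<gamma> ` T \<subseteq> {0<..} \<times> {0<..}"
  have "((\<lambda>t. hamiltonian N p s \<mu> (\<gamma> t)) has_derivative (\<lambda>_. 0)) (at t within T)" if t: "t \<in> T" for t
  proof -
    obtain x Y where \<gamma>: "\<gamma> t = (x, Y)" by fastforce
    then have pos: "0 < x" "0 < Y" using sub t by (auto simp: image_subset_iff)
    let ?w = "weighted_field N p s \<mu> q (x, Y)" and ?v = "field N p s \<mu> q (x, Y)"
    have g': "(\<gamma> has_derivative (\<lambda>r. r *\<^sub>R ?v)) (at t within T)"
      using sol t \<gamma> by (auto simp: solution_on_def has_vector_derivative_def)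
    have "((\<lambda>t. hamiltonian N p s \<mu> (\<gamma> t)) has_derivative
        (\<lambda>r. - snd ?w * fst (r *\<^sub>R ?v) + fst ?w * snd (r *\<^sub>R ?v))) (at t within T)"
      by (rule has_derivative_compose[OF g']) (use hamiltonian_has_derivative[OF assms pos] \<gamma> in simp)
    \<comment> \<open>The weighted field is a scalar multiple of the field, so the gradient of the
      Hamiltonian is orthogonal to the velocity.\<close>
    moreover have "(\<lambda>r. - snd ?w * fst (r *\<^sub>R ?v) + fst ?w * snd (r *\<^sub>R ?v)) = (\<lambda>_. 0)"
      by (simp add: weighted_field_def)
    ultimately show ?thesis by (simp only:)
  qed
  then obtain a where "\<forall>t\<in>T. hamiltonian N p s \<mu> (\<gamma> t) = a"
    using has_derivative_zero_constant[of T "\<lambda>t. hamiltonian N p s \<mu> (\<gamma> t)"] is_interval_convex[OF T] by auto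
  then show "(hamiltonian N p s \<mu> \<circ> \<gamma>) constant_on T" by (auto simp: constant_on_def)
qed

lemma bounded_solution_converges:
  fixes x Y :: "real \<Rightarrow> real"
  assumes "c \<noteq> 0" and sol: "solution_on (field N p s \<mu> q) {t0..} (\<lambda>t. (x t, Y t))"
    and Y: "\<And>t. t0 \<le> t \<Longrightarrow> 0 < Y t" and x: "\<And>t. t0 \<le> t \<Longrightarrow> x t < \<nu>p"
    and liminf: "0 < Liminf at_top (\<lambda>t. ereal (x t))" and bdd: "bdd_above (Y ` {t0..})"
  shows "\<exists>P. (P = (g, h N p g - \<mu>) \<and> \<mu> < h N p g \<or> P = (\<nu>m, 0) \<or> P = (\<nu>p, 0)) \<and>
    equilibrium (field N p s \<mu> q) P \<and> ((\<lambda>t. (x t, Y t)) \<longlongrightarrow> P) at_top"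
proof -
  \<comment> \<open>The positive lower limit keeps \<open>x\<close> above \<open>\<delta>\<close> at
    late times, and \<open>\<nu>p\<close> bounds it above; this gives the compact box in the
    quadrant.\<close>
  obtain \<delta> where \<delta>: "0 < \<delta>" "ereal \<delta> < Liminf at_top (\<lambda>t. ereal (x t))"
    using ereal_dense2[OF liminf] by auto
  have "eventually (\<lambda>t. \<delta> < x t) at_top" using less_LiminfD[OF \<delta>(2)] by simp
  then obtain T where T: "\<And>t. T \<le> t \<Longrightarrow> \<delta> < x t" unfolding eventually_at_top_linorder by blast
  obtain M where M: "\<And>t. t0 \<le> t \<Longrightarrow> Y t \<le> M" using bdd by (auto simp: bdd_above_def)
  define t1 where "t1 = max T t0"
  have "flow 1 {t1<..} x Y"
  proof -
    have "{t1<..} \<subseteq> {t0..}" by (auto simp: t1_def)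
    then show ?thesis using flow_of_solution[OF sol, of "{t1<..}"] by simp
  qed
  then consider "(x \<longlongrightarrow> g) at_top" "(Y \<longlongrightarrow> h N p g - \<mu>) at_top" "\<mu> < h N p g"
    | \<nu> where "\<nu> = \<nu>m \<or> \<nu> = \<nu>p" "(x \<longlongrightarrow> \<nu>) at_top" "(Y \<longlongrightarrow> 0) at_top"
    using bounded_flow_converges[OF \<open>c \<noteq> 0\<close> _ \<delta>(1), of t1 x Y \<nu>p M] T Y x M
    by (fastforce simp: t1_def less_imp_le)
  then show ?thesis
  proof cases
    case 1
    then show ?thesis
      by (intro exI[of _ "(g, h N p g - \<mu>)"])
        (auto simp: equilibrium_def field_eq F_interior zero_prod_def intro: tendsto_Pair)
  next
    case (2 \<nu>)
    have "F \<nu> 0 = 0" "G \<nu> 0 = 0" using 2(1) roots by (auto simp: F_def G_def)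
    then show ?thesis using 2
      by (intro exI[of _ "(\<nu>, 0)"]) (auto simp: equilibrium_def field_eq zero_prod_def intro: tendsto_Pair)
  qed
qed

end

theorem theorem1p2:
  fixes N p s \<mu> q \<nu>m \<nu>p :: real
  assumes "1 < p" and "p < N" and "- p < s"
    and "0 < \<mu>" and "\<mu> < mu_bar N p"
    and "p - 1 < q"
    and "0 < \<nu>m" and "\<nu>m < \<nu>p" and "h N p \<nu>m = \<mu>" and "h N p \<nu>p = \<mu>"
  shows
    "dulac_b N p s > - 1 \<and>
     (\<forall>x>0. \<forall>Y>0.
        has_divergence (weighted_field N p s \<mu> q) (dulac_div N p s q x Y) (x, Y) \<and>
        (q > p_star N p s - 1 \<longrightarrow> dulac_div N p s q x Y < 0) \<and>
        (q = p_star N p s - 1 \<longrightarrow> dulac_div N p s q x Y = 0) \<and>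
        (p - 1 < q \<and> q < p_star N p s - 1 \<longrightarrow> dulac_div N p s q x Y > 0)) \<and>
     (q \<noteq> p_star N p s - 1 \<longrightarrow>
        (\<nexists>S. S \<subseteq> {0<..} \<times> {0..} \<and> periodic_orbit (field N p s \<mu> q) S) \<and>
        (\<nexists>S. S \<subseteq> {0<..} \<times> {0..} \<and> separatrix_cycle (field N p s \<mu> q) S) \<and>
        (\<forall>(x :: real \<Rightarrow> real) Y t0.
           solution_on (field N p s \<mu> q) {t0..} (\<lambda>t. (x t, Y t)) \<and>
           (\<forall>t\<ge>t0. Y t > 0) \<and>
           (\<forall>t\<ge>t0. 0 < x t \<and> x t < \<nu>p) \<and>
           Liminf at_top (\<lambda>t. ereal (x t)) > 0 \<and>
           bdd_above (Y ` {t0..}) \<longrightarrow>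
           (\<exists>P. (P = (gamma_star p s q, h N p (gamma_star p s q) - \<mu>) \<and>
                   h N p (gamma_star p s q) > \<mu> \<or>
                 P = (\<nu>m, 0) \<or> P = (\<nu>p, 0)) \<and>
                equilibrium (field N p s \<mu> q) P \<and>
                ((\<lambda>t. (x t, Y t)) \<longlongrightarrow> P) at_top))) \<and>
     (q = p_star N p s - 1 \<longrightarrow>
        dulac_b N p s + 1 = p / (q - p + 1) \<and>
        hamiltonian_on ({0<..} \<times> {0<..}) (hamiltonian N p s \<mu>) (weighted_field N p s \<mu> q) \<and>
        first_integral_on ({0<..} \<times> {0<..}) (hamiltonian N p s \<mu>) (field N p s \<mu> q))"
proof -
  interpret planar_system N p s \<mu> q \<nu>m \<nu>p
    using assms by unfold_locales auto
  show ?thesis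
  proof (intro conjI impI allI)
    show "dulac_b N p s > - 1" by (rule b_gt)
  next
    fix x Y :: real assume pos: "0 < x" "0 < Y"
    show "has_divergence (weighted_field N p s \<mu> q) (dulac_div N p s q x Y) (x, Y)"
      using pos by (rule weighted_field_divergence)
    have "0 < x powr (p - 1) * Y powr b" using pos by simp
    then have "dulac_div N p s q x Y < 0 \<longleftrightarrow> 0 < c" "dulac_div N p s q x Y = 0 \<longleftrightarrow> c = 0"
      "0 < dulac_div N p s q x Y \<longleftrightarrow> c < 0"
      using g_pos unfolding dulac_div_eq
      by (auto simp: mult_less_0_iff zero_less_mult_iff zero_less_divide_iff divide_less_0_iff)
    then show "p_star N p s - 1 < q \<Longrightarrow> dulac_div N p s q x Y < 0"
      "q = p_star N p s - 1 \<Longrightarrow> dulac_div N p s q x Y = 0"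
      "p - 1 < q \<and> q < p_star N p s - 1 \<Longrightarrow> 0 < dulac_div N p s q x Y"
      using c_sign by auto
  next
    assume "q \<noteq> p_star N p s - 1"
    then have "c \<noteq> 0" using c_sign(2) by simp
    show "\<nexists>S. S \<subseteq> {0<..} \<times> {0..} \<and> periodic_orbit (field N p s \<mu> q) S"
      using no_periodic_orbit[OF \<open>c \<noteq> 0\<close>] by blast
    show "\<nexists>S. S \<subseteq> {0<..} \<times> {0..} \<and> separatrix_cycle (field N p s \<mu> q) S"
      using no_separatrix_cycle[OF \<open>c \<noteq> 0\<close>] by blast
    fix x Y :: "real \<Rightarrow> real" and t0
    assume "solution_on (field N p s \<mu> q) {t0..} (\<lambda>t. (x t, Y t)) \<and>
           (\<forall>t\<ge>t0. Y t > 0) \<and>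
           (\<forall>t\<ge>t0. 0 < x t \<and> x t < \<nu>p) \<and>
           Liminf at_top (\<lambda>t. ereal (x t)) > 0 \<and>
           bdd_above (Y ` {t0..})"
    then show "\<exists>P. (P = (gamma_star p s q, h N p (gamma_star p s q) - \<mu>) \<and>
                   h N p (gamma_star p s q) > \<mu> \<or>
                 P = (\<nu>m, 0) \<or> P = (\<nu>p, 0)) \<and>
                equilibrium (field N p s \<mu> q) P \<and>
                ((\<lambda>t. (x t, Y t)) \<longlongrightarrow> P) at_top"
      by (intro bounded_solution_converges[OF \<open>c \<noteq> 0\<close>, of t0 x Y, unfolded g_def]) auto
  next
    assume "q = p_star N p s - 1"
    then have "c = 0" using c_sign(2) by simp
    then have "k * (b + 1) * g = p * g" using k_b_g by (simp add: c_def)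
    then show "dulac_b N p s + 1 = p / (q - p + 1)" using g_pos k_pos by (simp add: eq_divide_eq mult.commute)
    show "hamiltonian_on ({0<..} \<times> {0<..}) (hamiltonian N p s \<mu>) (weighted_field N p s \<mu> q)"
      "first_integral_on ({0<..} \<times> {0<..}) (hamiltonian N p s \<mu>) (field N p s \<mu> q)"
      using \<open>c = 0\<close> by (rule hamiltonian_on_quadrant hamiltonian_first_integral)+
  qed
qed

end
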